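(* Let $\mathcal{E}$ be a metric space, let $\lambda,\kappa,\mu\colon\mathcal{E}\to[0,\infty)$ be continuous, and fix $t\ge 0$. Let $\{J_n\}_{n\in\mathbb{N}}$ be a sequence of $\mathcal{E}$-valued stochastic processes with càdlàg paths, and for each $n$ let $M_n(t)$ denote the number of jobs at time $t$ in the modulated infinite-server queue $(J_n,n\lambda,\kappa,\mu)$. Suppose that the laws $\nu_n$ of $\phi_t(J_n)$ on $\mathbb{R}$ satisfy a large deviations principle (LDP) with rate function $\psi$. Then $\frac{1}{n}M_n(t)$ satisfies an LDP with rate function $$I(a)=\inf_{\gamma\in\mathcal{R}(t)}\big[\ell(\gamma;a)+\psi(\gamma)\big],\qquad a\in\mathbb{R},$$ that is, $\limsup_{n\to\infty}\frac1n\log\mathbb{P}(\frac1n M_n(t)\in F)\le-\inf_{a\in F}I(a)$ for every closed $F\subset\mathbb{R}$ and $\liminf_{n\to\infty}\frac1n\log\mathbb{P}(\frac1n M_n(t)\in G)\ge-\inf_{a\in G}I(a)$ for every open $G\subset\mathbb{R}$.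
   Context: For a càdlàg $f\colon[0,\infty)\to\mathcal{E}$ and $t\ge0$, $\phi_t(f)=\int_0^t\lambda(f(s))\exp\!\big(-\kappa(f(s))\int_s^t\mu(f(r))\,dr\big)\,ds$. The modulated infinite-server queue $(J,\lambda,\kappa,\mu)$: $J$ is an $\mathcal{E}$-valued càdlàg background process; the system starts empty; jobs arrive at the jump times $\tau_1,\tau_2,\dots$ of $Y(t)=\bar Y(\int_0^t\lambda(J(s))\,ds)$, where $\bar Y$ is a standard Poisson process independent of $J$; job $k$ gets service requirement $\bar Z_k/\kappa(J(\tau_k))$ (equal to $\infty$ if $\kappa(J(\tau_k))=0$), where $\bar Z_1,\bar Z_2,\dots$ are i.i.d. standard exponential, independent of everything else; each job has its own server, which processes work at rate $\mu(J(s))$ at time $s$; a job leaves once its requirement has been processed. The queue $(J_n,n\lambda,\kappa,\mu)$ is the same with arrival rate function $n\lambda$ and background process $J_n$. A sequence of probability measures $\tau_n$ on a topological space satisfies an LDP with rate function $\rho$ if $\rho\colon\to[0,\infty]$ is lower semicontinuous (not necessarily with compact level sets), $\limsup\frac1n\log\tau_n(F)\le-\inf_F\rho$ for closed $F$ and $\liminf\frac1n\log\tau_n(G)\ge-\inf_G\rho$ for open $G$. A number $\gamma\in[0,\infty)$ is an attainable parameter at time $t$ if for every $\epsilon>0$ there is $N_\epsilon$ with $\mathbb{P}(\phi_t(J_n)\in(\gamma-\epsilon,\gamma+\epsilon))>0$ for all $n\ge N_\epsilon$; $\mathcal{R}(t)$ is the set of attainable parameters at time $t$. For $\gamma\ge0$,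 $\ell(\gamma;a)=\infty$ if $a<0$, $\ell(\gamma;0)=\gamma$, and $\ell(\gamma;a)=\gamma-a+a\log(a/\gamma)$ for $a>0$ (interpreted as $\infty$ when $\gamma=0$, $a>0$); this is the Fenchel–Legendre transform of the cumulant generating function of a Poisson($\gamma$) variable. *)

theory Defs
  imports "HOL-Probability.Probability"
begin

definition cadlag :: "(real \<Rightarrow> 'e::topological_space) \<Rightarrow> bool" where
  "cadlag f \<longleftrightarrow> (\<forall>t\<ge>0. (f \<longlongrightarrow> f t) (at_right t)) \<and>
                 (\<forall>t>0. \<exists>l. (f \<longlongrightarrow> l) (at_left t))"

definition phi :: "('e \<Rightarrow> real) \<Rightarrow> ('e \<Rightarrow> real) \<Rightarrow> ('e \<Rightarrow> real) \<Rightarrow> real \<Rightarrow> (real \<Rightarrow> 'e) \<Rightarrow> real" where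
  "phi lam kap mu t f =
     integral {0..t} (\<lambda>s. lam (f s) * exp (- kap (f s) * integral {s..t} (\<lambda>r. mu (f r))))"

definition std_poisson_process :: "'a measure \<Rightarrow> ('a \<Rightarrow> real \<Rightarrow> nat) \<Rightarrow> bool" where
  "std_poisson_process M N \<longleftrightarrow>
     N \<in> measurable M (Pi\<^sub>M UNIV (\<lambda>_. count_space UNIV)) \<and>
     (\<forall>\<omega>\<in>space M. N \<omega> 0 = 0 \<and> mono_on {0..} (N \<omega>) \<and>
        (\<forall>t\<ge>0. (N \<omega> \<longlongrightarrow> N \<omega> t) (at_right t))) \<and>
     (\<forall>s t. 0 \<le> s \<and> s < t \<longrightarrow>
        distr M (count_space UNIV) (\<lambda>\<omega>. N \<omega> t - N \<omega> s) = measure_pmf (poisson_pmf (t - s))) \<and>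
     (\<forall>(ts :: nat \<Rightarrow> real) k. 0 \<le> ts 0 \<and> (\<forall>i<k. ts i \<le> ts (Suc i)) \<longrightarrow>
        prob_space.indep_vars M (\<lambda>_. count_space UNIV)
          (\<lambda>i \<omega>. N \<omega> (ts (Suc i)) - N \<omega> (ts i)) {..<k})"

text \<open>Number of jobs at time t in the modulated infinite-server queue with
  background path j, arrival rate function lam, service-rate factor kap, speed mu,
  driven by the standard Poisson path Yb and the standard exponentials Z 1, Z 2, ...
  Arrivals: jump times of Y(s) = Yb(int_0^s lam(j r) dr); the k-th arrival time is
  tau_k = inf{s >= 0. Y s >= k}; job k has requirement Z k / kap(j tau_k)
  (infinite if kap(j tau_k) = 0) and is still present at time t iff the work
  processed in [tau_k, t] is below its requirement.\<close>
definition queue_count :: "('e \<Rightarrow> real) \<Rightarrow> ('e \<Rightarrow> real) \<Rightarrow> ('e \<Rightarrow> real) \<Rightarrow>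
    (real \<Rightarrow> 'e) \<Rightarrow> (real \<Rightarrow> nat) \<Rightarrow> (nat \<Rightarrow> real) \<Rightarrow> real \<Rightarrow> nat" where
  "queue_count lam kap mu j Yb Z t =
     (let Y = (\<lambda>s. Yb (integral {0..s} (\<lambda>r. lam (j r))));
          tau = (\<lambda>k::nat. Inf {s. 0 \<le> s \<and> k \<le> Y s})
      in card {k \<in> {1..Y t}.
                 kap (j (tau k)) = 0 \<or>
                 integral {tau k..t} (\<lambda>r. mu (j r)) < Z k / kap (j (tau k))})"

text \<open>Independence of two random elements with possibly different codomain types
  (the unfolding of the library's indep_var, which forces equal types).\<close>
definition indep_rv :: "'a measure \<Rightarrow> 'b measure \<Rightarrow> ('a \<Rightarrow> 'b) \<Rightarrow> 'c measure \<Rightarrow> ('a \<Rightarrow> 'c) \<Rightarrow> bool" where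
  "indep_rv M S X T Y \<longleftrightarrow>
     X \<in> measurable M S \<and> Y \<in> measurable M T \<and>
     prob_space.indep_set M
       (sigma_sets (space M) {X -` A \<inter> space M | A. A \<in> sets S})
       (sigma_sets (space M) {Y -` A \<inter> space M | A. A \<in> sets T})"

definition nlog :: "nat \<Rightarrow> real \<Rightarrow> ereal" where
  "nlog n p = (if p = 0 then -\<infinity> else ereal (ln p / real n))"

text \<open>Large deviations principle (speed n) for a sequence of probability measures
  on the Borel sets of a topological space, with a lower semicontinuous rate
  function with values in [0,infinity] (compact level sets not required).\<close>
definition LDP :: "(nat \<Rightarrow> 'b::topological_space measure) \<Rightarrow> ('b \<Rightarrow> ereal) \<Rightarrow> bool" where
  "LDP \<nu> \<rho> \<longleftrightarrow>
     (\<forall>x. 0 \<le> \<rho> x) \<and> (\<forall>c. closed {x. \<rho> x \<le> c}) \<and>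
     (\<forall>F. closed F \<longrightarrow> limsup (\<lambda>n. nlog n (measure (\<nu> n) F)) \<le> - (INF x\<in>F. \<rho> x)) \<and>
     (\<forall>G. open G \<longrightarrow> liminf (\<lambda>n. nlog n (measure (\<nu> n) G)) \<ge> - (INF x\<in>G. \<rho> x))"

text \<open>Legendre transform of the Poisson(gamma) cumulant generating function.\<close>
definition ell :: "real \<Rightarrow> real \<Rightarrow> ereal" where
  "ell \<gamma> a = (if a < 0 then \<infinity> else if a = 0 then ereal \<gamma>
               else if \<gamma> = 0 then \<infinity> else ereal (\<gamma> - a + a * ln (a / \<gamma>)))"

definition attainable :: "(nat \<Rightarrow> 'a measure) \<Rightarrow> (nat \<Rightarrow> 'a \<Rightarrow> real \<Rightarrow> 'e) \<Rightarrow>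
    ('e \<Rightarrow> real) \<Rightarrow> ('e \<Rightarrow> real) \<Rightarrow> ('e \<Rightarrow> real) \<Rightarrow> real \<Rightarrow> real set" where
  "attainable M J lam kap mu t =
     {\<gamma>. 0 \<le> \<gamma> \<and> (\<forall>\<epsilon>>0. \<exists>N. \<forall>n\<ge>N.
        measure (M n) {\<omega> \<in> space (M n). phi lam kap mu t (J n \<omega>) \<in> {\<gamma> - \<epsilon> <..< \<gamma> + \<epsilon>}} > 0)}"

end

theory Submission
  imports Defs "HOL-Real_Asymp.Real_Asymp"
begin

text \<open>Conditionally on the background path, the jobs present at time \<open>t\<close> form an independent thinning
  of a Poisson process, so their number is Poisson with mean \<open>n * phi\<close>. This is proved through the
  generating function: integrating out the service requirements turns each job into a factor
  \<open>q (tau)\<close> at its arrival time, and the product over all arrivals is the limit of products over a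
  deterministic time grid. Evaluating the factors at right endpoints makes this limit hold for every
  outcome, because all paths involved are right-continuous, and the grid products are computed from
  the independent Poisson increments.

  A mixture of Poisson laws whose mixing variables satisfy an LDP satisfies the LDP with the
  minimised sum of rates. Upper bound: by Chernoff's inequality the Poisson probability of \<open>n * F\<close> is
  at most \<open>2 * exp (- n * m \<gamma>)\<close> with \<open>m \<gamma>\<close> the infimum of \<open>ell \<gamma>\<close> over \<open>F\<close>, and \<open>m\<close> is
  continuous, so Laplace's method works without compact level sets. Lower bound: Stirling's formula
  at the single point \<open>\<lfloor>n * a\<rfloor>\<close>. Outside the attainable parameters \<open>\<psi>\<close> is infinite.\<close>

section \<open>Poisson weights and their rate function\<close>

text \<open>Paths are measurable only for the product sigma-algebra over an uncountable time set,
  where evaluation at a random time is not measurable on the space of all functions. Every such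
  quantity is therefore a pointwise limit of functionals of countably many fixed times, with
  right-continuity supplying the limit. Independence is used twice: the requirements are integrated
  out with background and clock frozen, then the clock with the background frozen. Both are Fubini
  on a product law, so no conditional distribution appears. Each job contributes a factor in [0,1],
  hence all integrands are bounded by 1 and dominated convergence is immediate.

  On the large deviations side the Poisson estimates must be uniform in the mean before they can be
  integrated over it: the upper one is non-asymptotic, the lower one holds on a neighbourhood of
  \<gamma>. Compactness comes from \<open>ell\<close> instead of \<psi>: a bound on
  \<open>ell \<gamma> a\<close> and on one of the two arguments bounds the other.\<close>

definition pois :: "real \<Rightarrow> nat \<Rightarrow> real" where
  "pois x k = x ^ k / fact k * exp (- x)"

text \<open>A real function of the mean, because it is later integrated over a random mean. Since
  \<open>0 ^ 0 = 1\<close>, mean 0 gives the point mass at 0.\<close>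

definition pois_set :: "nat set \<Rightarrow> real \<Rightarrow> real" where
  "pois_set S x = (\<Sum>k. if k \<in> S then pois x k else 0)"

lemma pois_nonneg: "0 \<le> x \<Longrightarrow> 0 \<le> pois x k"
  by (simp add: pois_def)

lemma pois_pgf_sums: "(\<lambda>k. pois x k * z ^ k) sums exp (- (1 - z) * x)"
proof -
  have "(\<lambda>k. (z * x) ^ k /\<^sub>R fact k) sums exp (z * x)" by (rule exp_converges)
  then have "(\<lambda>k. (z * x) ^ k /\<^sub>R fact k * exp (- x)) sums (exp (z * x) * exp (- x))"
    by (rule sums_mult2)
  then show ?thesis
    by (simp add: pois_def exp_add [symmetric] algebra_simps power_mult_distrib divide_inverse)
qed

lemma pois_sums: "pois x sums 1"
  using pois_pgf_sums[of x 1] by simp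

lemma summable_pois_set: assumes "0 \<le> x" shows "summable (\<lambda>k. if k \<in> S then pois x k else 0)"
  by (rule summable_comparison_test'[OF sums_summable[OF pois_sums[of x]], of 0])
     (auto simp: pois_nonneg assms)

lemma pois_set_nonneg: "0 \<le> x \<Longrightarrow> 0 \<le> pois_set S x"
  unfolding pois_set_def by (rule suminf_nonneg[OF summable_pois_set]) (auto simp: pois_nonneg)

lemma pois_set_le_1: assumes "0 \<le> x" shows "pois_set S x \<le> 1"
proof -
  have "pois_set S x \<le> suminf (pois x)" unfolding pois_set_def
    by (rule suminf_le[OF _ summable_pois_set[OF assms] sums_summable[OF pois_sums]])
       (auto simp: pois_nonneg assms)
  then show ?thesis using sums_unique[OF pois_sums[of x]] by simp
qed

lemma pois_le_1: assumes "0 \<le> x" shows "pois x k \<le> 1"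
  using pois_set_le_1[OF assms, of "{k}"] sums_unique[OF sums_single[of k "pois x"]]
  by (simp add: pois_set_def)

lemma pois_set_union_le:
  assumes "0 \<le> x" "S \<subseteq> A \<union> B" shows "pois_set S x \<le> pois_set A x + pois_set B x"
proof -
  have "pois_set S x \<le> (\<Sum>k. (if k \<in> A then pois x k else 0) + (if k \<in> B then pois x k else 0))"
    unfolding pois_set_def
    by (rule suminf_le[OF _ summable_pois_set[OF assms(1)] summable_add[OF summable_pois_set summable_pois_set]])
       (use assms in \<open>auto simp: pois_nonneg\<close>)
  then show ?thesis
    by (simp add: pois_set_def suminf_add[OF summable_pois_set summable_pois_set] assms)
qed

text \<open>Exponential Markov inequality: on \<open>S\<close> the factor
  \<open>exp (\<theta> * k - w)\<close> is at least 1, and its Poisson mean is the generating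
  function at \<open>exp \<theta>\<close>. Both signs of \<theta> are allowed, so one statement
  serves both tails.\<close>

lemma pois_set_chernoff:
  assumes "0 \<le> x" "\<And>k. k \<in> S \<Longrightarrow> w \<le> \<theta> * real k"
  shows "pois_set S x \<le> exp (x * (exp \<theta> - 1) - w)"
proof -
  have s: "(\<lambda>k. exp (- w) * (pois x k * exp \<theta> ^ k)) sums (exp (- w) * exp (- (1 - exp \<theta>) * x))"
    by (intro sums_mult pois_pgf_sums)
  have "pois_set S x \<le> (\<Sum>k. exp (- w) * (pois x k * exp \<theta> ^ k))"
    unfolding pois_set_def
  proof (rule suminf_le[OF _ summable_pois_set[OF assms(1)] sums_summable[OF s]])
    fix k
    show "(if k \<in> S then pois x k else 0) \<le> exp (- w) * (pois x k * exp \<theta> ^ k)"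
    proof (cases "k \<in> S")
      case True
      then have "1 \<le> exp (\<theta> * real k - w)" using assms(2)[of k] by simp
      also have "\<dots> = exp (- w) * exp \<theta> ^ k"
        by (simp add: exp_of_nat_mult [symmetric] exp_add [symmetric] mult.commute)
      finally have "pois x k * 1 \<le> pois x k * (exp (- w) * exp \<theta> ^ k)"
        by (intro mult_left_mono pois_nonneg assms)
      then show ?thesis using True by (simp add: mult_ac)
    qed (simp add: pois_nonneg assms)
  qed
  also have "\<dots> = exp (x * (exp \<theta> - 1) - w)"
    using sums_unique[OF s] by (simp add: exp_add [symmetric] algebra_simps)
  finally show ?thesis .
qed

section \<open>The rate function \<open>ell\<close> as a Legendre transform\<close>

lemma ell_nonneg: assumes "0 \<le> \<gamma>" shows "0 \<le> ell \<gamma> a"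
proof (cases "0 < a \<and> 0 < \<gamma>")
  case True
  have "ln (\<gamma> / a) \<le> \<gamma> / a - 1" using True by (intro ln_le_minus_one) auto
  then have "a * ln (\<gamma> / a) \<le> a * (\<gamma> / a - 1)" using True by (intro mult_left_mono) auto
  then have "a * (ln \<gamma> - ln a) \<le> \<gamma> - a" using True by (simp add: ln_div algebra_simps)
  then have "0 \<le> \<gamma> - a + a * ln (a / \<gamma>)" using True by (simp add: ln_div algebra_simps)
  then show ?thesis using True by (simp add: ell_def)
qed (use assms in \<open>auto simp: ell_def\<close>)

text \<open>Duality turns a sublevel set of \<open>ell\<close> into an intersection of conditions
  that are affine in \<open>a\<close> and in \<gamma>. These pass to limits without a case
  distinction at the boundary values \<open>a = 0\<close> and \<open>\<gamma> = 0\<close>.\<close>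

lemma ell_le_iff:
  assumes "0 \<le> \<gamma>"
  shows "ell \<gamma> a \<le> ereal u \<longleftrightarrow> (\<forall>\<theta>. \<theta> * a - \<gamma> * (exp \<theta> - 1) \<le> u)"
proof
  assume le: "ell \<gamma> a \<le> ereal u"
  show "\<forall>\<theta>. \<theta> * a - \<gamma> * (exp \<theta> - 1) \<le> u"
  proof
    fix \<theta> :: real
    consider "a = 0" | "0 < a" "0 < \<gamma>"
      using le assms by (fastforce simp: ell_def split: if_splits)
    then show "\<theta> * a - \<gamma> * (exp \<theta> - 1) \<le> u"
    proof cases
      case 1
      then have "\<gamma> \<le> u" using le by (simp add: ell_def)
      moreover have "0 \<le> \<gamma> * exp \<theta>" using assms by simp
      ultimately show ?thesis using 1 by (simp add: algebra_simps)
    next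
      case 2
      let ?x = "\<gamma> * exp \<theta> / a"
      have "ln ?x \<le> ?x - 1" using 2 by (intro ln_le_minus_one) auto
      moreover have "ln ?x = ln \<gamma> + \<theta> - ln a" using 2 by (simp add: ln_div ln_mult)
      ultimately have "a * (ln \<gamma> + \<theta> - ln a) \<le> a * (?x - 1)" using 2
        by (intro mult_left_mono) auto
      then have "a * (ln \<gamma> + \<theta> - ln a) \<le> \<gamma> * exp \<theta> - a" using 2 by (simp add: algebra_simps)
      moreover have "\<gamma> - a + a * (ln a - ln \<gamma>) \<le> u" using le 2 by (simp add: ell_def ln_div)
      ultimately show ?thesis by (simp add: algebra_simps)
    qed
  qed
next
  assume all: "\<forall>\<theta>. \<theta> * a - \<gamma> * (exp \<theta> - 1) \<le> u"
  consider "a < 0" | "a = 0" | "0 < a" "\<gamma> = 0" | "0 < a" "0 < \<gamma>" using assms by linarith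
  then show "ell \<gamma> a \<le> ereal u"
  proof cases
    case 1
    \<comment> \<open>A negative \<theta> with \<open>\<theta> * a = \<bar>u\<bar> + 1\<close>; the
      exponential term then only increases the dual expression, which exceeds
      \<open>u\<close>.\<close>
    let ?t = "(\<bar>u\<bar> + 1) / a"
    have "?t \<le> 0" using 1 by (simp add: divide_nonneg_neg)
    then have "\<gamma> * (exp ?t - 1) \<le> 0" using assms by (intro mult_nonneg_nonpos) auto
    moreover have "?t * a = \<bar>u\<bar> + 1" using 1 by simp
    ultimately show ?thesis using all[rule_format, of ?t] by linarith
  next
    case 2
    \<comment> \<open>At \<open>a = 0\<close> the supremum \<gamma> of the dual expression is its
      limit as \<theta> tends to minus infinity.\<close>
    have "((\<lambda>\<theta>. \<theta> * a - \<gamma> * (exp \<theta> - 1)) \<longlongrightarrow> 0 - \<gamma> * (0 - 1)) at_bot"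
      unfolding 2 by (intro tendsto_intros) (auto intro: exp_at_bot)
    then have "\<gamma> \<le> u" using all by (auto dest!: tendsto_upperbound)
    then show ?thesis using 2 by (simp add: ell_def)
  next
    case 3
    then show ?thesis using all[rule_format, of "(\<bar>u\<bar> + 1) / a"] by simp
  next
    case 4
    \<comment> \<open>The dual expression is maximal at
      \<open>\<theta> = ln (a / \<gamma>)\<close>.\<close>
    then have e: "exp (ln (a / \<gamma>)) = a / \<gamma>" by simp
    have "ln (a / \<gamma>) * a - \<gamma> * (a / \<gamma> - 1) \<le> u"
      using all[rule_format, of "ln (a / \<gamma>)"] unfolding e .
    then show ?thesis using 4 by (simp add: ell_def algebra_simps)
  qed
qed

text \<open>Duality at \<theta> = 1 and \<theta> = -1, with the crude estimates
  \<open>exp 1 - 1 \<le> 2\<close> and \<open>1 - exp (-1) \<ge> 1/2\<close>. These linear bounds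
  supply the bounded sequences in all compactness arguments below.\<close>

lemma ell_le_bounds:
  assumes "0 \<le> \<gamma>" "ell \<gamma> a \<le> ereal u"
  shows "0 \<le> a" "a \<le> u + 2 * \<gamma>" "\<gamma> \<le> 2 * (u + a)"
proof -
  show a: "0 \<le> a" using assms by (auto simp: ell_def split: if_splits)
  have *: "\<theta> * a - \<gamma> * (exp \<theta> - 1) \<le> u" for \<theta>
    using assms by (simp add: ell_le_iff)
  have "\<gamma> * (exp 1 - 1) \<le> \<gamma> * 2" using exp_le assms(1) by (intro mult_left_mono) auto
  then show "a \<le> u + 2 * \<gamma>" using *[of 1] by simp
  have "exp (- 1) \<le> (1/2::real)" using exp_ge_add_one_self[of "1::real"] by (simp add: exp_minus field_simps)
  then have "\<gamma> * (exp (- 1) - 1) \<le> \<gamma> * (- (1/2))" using assms(1) by (intro mult_left_mono) auto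
  then show "\<gamma> \<le> 2 * (u + a)" using *[of "-1"] by simp
qed

text \<open>For fixed \<open>a > 0\<close>, \<open>ell\<close> is continuous in \<gamma> down to
  \<gamma> = 0, where it is infinite. Intersecting over \<open>a \<in> F\<close> gives upper
  semicontinuity of the infimum of \<open>ell \<gamma>\<close> over \<open>F\<close>.\<close>

lemma closed_ell_ge:
  "closed {\<gamma>. 0 \<le> \<gamma> \<and> ereal c \<le> ell \<gamma> a}"
proof (cases "0 < a")
  case True
  have "open {\<gamma> \<in> {0<..}. \<gamma> - a + a * ln (a / \<gamma>) < c}"
  proof -
    have "continuous_on {0<..} (\<lambda>\<gamma>. \<gamma> - a + a * ln (a / \<gamma>))"
      using True by (intro continuous_intros) auto
    from continuous_on_open_vimage[THEN iffD1, OF _ this, rule_format, of "{..<c}"]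
    show ?thesis by (simp add: vimage_def Int_def conj_commute)
  qed
  then have "open ({..<0} \<union> {\<gamma> \<in> {0<..}. \<gamma> - a + a * ln (a / \<gamma>) < c})" by auto
  then have "closed (- ({..<0} \<union> {\<gamma> \<in> {0<..}. \<gamma> - a + a * ln (a / \<gamma>) < c}))" by (rule closed_Compl)
  also have "- ({..<0} \<union> {\<gamma> \<in> {0<..}. \<gamma> - a + a * ln (a / \<gamma>) < c}) = {\<gamma>. 0 \<le> \<gamma> \<and> ereal c \<le> ell \<gamma> a}"
    using True by (auto simp: ell_def not_less)
  finally show ?thesis .
next
  case False
  then consider "a < 0" | "a = 0" by linarith
  then show ?thesis
  proof cases
    case 1
    then have "{\<gamma>. 0 \<le> \<gamma> \<and> ereal c \<le> ell \<gamma> a} = {0..}" by (auto simp: ell_def)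
    then show ?thesis by simp
  next
    case 2
    then have "{\<gamma>. 0 \<le> \<gamma> \<and> ereal c \<le> ell \<gamma> a} = {max 0 c..}" by (auto simp: ell_def)
    then show ?thesis by simp
  qed
qed

text \<open>The matching lower semicontinuity. A projection of a closed set need not be closed; here
  the witnesses \<open>a\<close> stay bounded while \<gamma> does, so a subsequence converges in
  \<open>F\<close> and the dual inequalities pass to the limit.\<close>

lemma closed_ell_le_proj:
  assumes "closed F"
  shows "closed {\<gamma>. 0 \<le> \<gamma> \<and> (\<exists>a\<in>F. ell \<gamma> a \<le> ereal c)}"
  unfolding closed_sequential_limits
proof (intro allI impI)
  fix x l assume *: "(\<forall>n. x n \<in> {\<gamma>. 0 \<le> \<gamma> \<and> (\<exists>a\<in>F. ell \<gamma> a \<le> ereal c)}) \<and> x \<longlonglongrightarrow> l"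
  then obtain a where a: "\<And>n. a n \<in> F" "\<And>n. ell (x n) (a n) \<le> ereal c" and x: "\<And>n. 0 \<le> x n" "x \<longlonglongrightarrow> l"
    by simp metis
  have l: "0 \<le> l" using x by (auto intro: LIMSEQ_le_const)
  obtain B where B: "\<And>n. \<bar>x n\<bar> \<le> B"
    using convergent_imp_Bseq[of x] x(2) by (auto simp: convergent_def Bseq_def)
  have "bounded (range a)"
    unfolding bounded_iff
  proof (intro exI ballI, safe)
    fix n show "norm (a n) \<le> c + 2 * B"
      using ell_le_bounds[OF x(1) a(2)[of n]] B[of n] by auto
  qed
  then obtain b r where r: "strict_mono (r::nat\<Rightarrow>nat)" "(a \<circ> r) \<longlonglongrightarrow> b"
    using bounded_imp_convergent_subsequence by blast
  have b: "b \<in> F" using closed_sequentially[OF assms _ r(2)] a(1) by simp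
  have xr: "(\<lambda>n. x (r n)) \<longlonglongrightarrow> l" using LIMSEQ_subseq_LIMSEQ[OF x(2) r(1)] by (simp add: o_def)
  have ar: "(\<lambda>n. a (r n)) \<longlonglongrightarrow> b" using r(2) by (simp add: o_def)
  have "ell l b \<le> ereal c"
    unfolding ell_le_iff[OF l]
  proof
    fix \<theta>
    have "(\<lambda>n. \<theta> * a (r n) - x (r n) * (exp \<theta> - 1)) \<longlonglongrightarrow> \<theta> * b - l * (exp \<theta> - 1)"
      by (intro tendsto_intros xr ar)
    then show "\<theta> * b - l * (exp \<theta> - 1) \<le> c"
      by (rule LIMSEQ_le_const2) (use a(2) x(1) in \<open>auto simp: ell_le_iff\<close>)
  qed
  then show "l \<in> {\<gamma>. 0 \<le> \<gamma> \<and> (\<exists>a\<in>F. ell \<gamma> a \<le> ereal c)}" using b l by auto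
qed

section \<open>Non-asymptotic upper bounds for Poisson probabilities\<close>

text \<open>Chernoff's bound at the maximiser \<open>\<theta> = ln (b / \<gamma>)\<close>, whose
  sign matches the side of \<gamma> on which \<open>S\<close> lies. For \<open>b = 0\<close> or
  \<open>\<gamma> = 0\<close> this maximiser would be infinite, so the probability is evaluated
  directly.\<close>

lemma pois_set_tail_le:
  assumes n: "0 < n" and \<gamma>: "0 \<le> \<gamma>" and b: "0 \<le> b" "ereal c \<le> ell \<gamma> b" "0 < c"
    and S: "(\<gamma> \<le> b \<and> (\<forall>k\<in>S. b \<le> real k / real n)) \<or> (b \<le> \<gamma> \<and> (\<forall>k\<in>S. real k / real n \<le> b))"
  shows "pois_set S (real n * \<gamma>) \<le> exp (- real n * c)"
proof -
  \<comment> \<open>The combination \<open>b = \<gamma> = 0\<close> is excluded by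
    \<open>0 < c\<close>, since \<open>ell\<close> vanishes there.\<close>
  consider "b = 0" "0 < \<gamma>" | "0 < b" "0 < \<gamma>" | "\<gamma> = 0" "0 < b" 
    using b \<gamma> by (cases "b = 0"; cases "\<gamma> = 0") (auto simp: ell_def)
  then show ?thesis
  proof cases
    case 1
    then have S0: "S \<subseteq> {0}" using S n by (force simp: field_simps)
    have "c \<le> \<gamma>" using b 1 by (simp add: ell_def)
    have "pois_set S (real n * \<gamma>) \<le> pois_set {0} (real n * \<gamma>) + pois_set {} (real n * \<gamma>)"
      using S0 \<gamma> by (intro pois_set_union_le) auto
    also have "\<dots> = exp (- (real n * \<gamma>))"
      using sums_unique[OF sums_single[of 0 "pois (real n * \<gamma>)"]] by (simp add: pois_set_def pois_def)
    also have "\<dots> \<le> exp (- real n * c)" using \<open>c \<le> \<gamma>\<close> by (simp add: mult_left_mono)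
    finally show ?thesis .
  next
    case 2
    let ?\<theta> = "ln (b / \<gamma>)"
    have "c \<le> \<gamma> - b + b * ?\<theta>" using b 2 by (simp add: ell_def)
    then have c: "n * c \<le> n * (\<gamma> - b + b * ?\<theta>)" by (intro mult_left_mono) auto
    have "pois_set S (real n * \<gamma>) \<le> exp (real n * \<gamma> * (exp ?\<theta> - 1) - ?\<theta> * (n * b))"
    proof (rule pois_set_chernoff)
      fix k assume k: "k \<in> S"
      show "?\<theta> * (n * b) \<le> ?\<theta> * real k"
      proof (cases "\<gamma> \<le> b \<and> (\<forall>k\<in>S. b \<le> real k / real n)")
        case True
        then have "0 \<le> ?\<theta>" using 2 by simp
        moreover have "n * b \<le> k" using True k n by (auto simp: field_simps)
        ultimately show ?thesis by (intro mult_left_mono)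
      next
        case False
        then have F: "b \<le> \<gamma>" "real k / real n \<le> b" using S k by auto
        then have "?\<theta> \<le> 0" using 2 by simp
        moreover have "k \<le> n * b" using F k n by (auto simp: field_simps)
        ultimately show ?thesis by (intro mult_left_mono_neg)
      qed
    qed (use \<gamma> in auto)
    also have "\<dots> \<le> exp (- real n * c)"
      using c 2 by (simp add: algebra_simps)
    finally show ?thesis .
  next
    case 3
    then have "0 \<notin> S" using S by auto
    then have "(\<lambda>k. if k \<in> S then pois (real n * \<gamma>) k else 0) = (\<lambda>_. 0)"
      using 3 by (auto simp: pois_def power_0_left fun_eq_iff)
    then have "pois_set S (real n * \<gamma>) = 0" by (simp add: pois_set_def)
    then show ?thesis by simp
  qed
qed

text \<open>On each side of \<gamma> the closed set \<open>F\<close> has a point nearest to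
  \<gamma>, and the tail beyond it is bounded through \<open>ell\<close> at that point; two tails
  give the factor 2. The bound holds for every \<open>n > 0\<close> and every \<gamma>, so it can be
  applied to a random \<gamma>.\<close>

lemma pois_set_closed_le:
  assumes n: "0 < n" and \<gamma>: "0 \<le> \<gamma>" and F: "closed F" and c: "\<And>a. a \<in> F \<Longrightarrow> ereal c \<le> ell \<gamma> a"
  shows "pois_set {k. real k / real n \<in> F} (real n * \<gamma>) \<le> 2 * exp (- real n * c)"
proof (cases "0 < c")
  case False
  have "pois_set {k. real k / real n \<in> F} (real n * \<gamma>) \<le> 1"
    using \<gamma> by (intro pois_set_le_1) auto
  moreover have "1 \<le> exp (- real n * c)" using False by (simp add: mult_nonneg_nonpos)
  ultimately show ?thesis by linarith
next
  case True
  let ?A = "{k. real k / real n \<in> F \<inter> {\<gamma>..}}" and ?B = "{k. real k / real n \<in> F \<inter> {0..\<gamma>}}"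
  have "pois_set ?A (real n * \<gamma>) \<le> exp (- real n * c)"
  proof (cases "F \<inter> {\<gamma>..} = {}")
    case True
    then show ?thesis by (simp add: pois_set_def)
  next
    case ne: False
    have bb: "bdd_below (F \<inter> {\<gamma>..})" by auto
    have "Inf (F \<inter> {\<gamma>..}) \<in> F \<inter> {\<gamma>..}" using ne F by (intro closed_contains_Inf) auto
    then show ?thesis using n \<gamma> c True
      by (intro pois_set_tail_le[of n \<gamma> "Inf (F \<inter> {\<gamma>..})"]) (auto intro: cInf_lower[OF _ bb])
  qed
  moreover have "pois_set ?B (real n * \<gamma>) \<le> exp (- real n * c)"
  proof (cases "F \<inter> {0..\<gamma>} = {}")
    case True
    then show ?thesis by (simp add: pois_set_def)
  next
    case ne: False
    have bb: "bdd_above (F \<inter> {0..\<gamma>})" by auto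
    have "Sup (F \<inter> {0..\<gamma>}) \<in> F \<inter> {0..\<gamma>}" using ne F by (intro closed_contains_Sup) auto
    then show ?thesis using n \<gamma> c True
      by (intro pois_set_tail_le[of n \<gamma> "Sup (F \<inter> {0..\<gamma>})"]) (auto intro: cSup_upper[OF _ bb])
  qed
  moreover have "pois_set {k. real k / real n \<in> F} (real n * \<gamma>) \<le> pois_set ?A (real n * \<gamma>) + pois_set ?B (real n * \<gamma>)"
    using \<gamma> by (intro pois_set_union_le) auto
  ultimately show ?thesis by linarith
qed

section \<open>Stirling's bound and the lower bound for a single weight\<close>

text \<open>The quotient of successive right-hand sides is at least \<open>k + 1\<close> because
  \<open>(1 + 1/k) ^ (k + 1) \<ge> exp 1\<close>, which is \<open>ln x \<le> x - 1\<close> at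
  \<open>x = 1 - 1/(k+1)\<close>. The excess over Stirling's formula is polynomial in
  \<open>k\<close>, invisible on the exponential scale.\<close>

lemma fact_le_power_exp: assumes "0 < k" shows "fact k \<le> real k ^ (k + 1) * exp (1 - real k)"
  using assms
proof (induction k rule: nat_induct_non_zero)
  case (Suc k)
  have "1 / real (Suc k) \<le> - ln (1 - 1 / real (Suc k))"
    using ln_le_minus_one[of "1 - 1 / real (Suc k)"] Suc by simp
  also have "\<dots> = ln (real (Suc k) / real k)"
    using Suc by (simp add: ln_div field_simps flip: ln_inverse)
  finally have "1 \<le> real (Suc k) * ln (real (Suc k) / real k)" by (simp add: field_simps del: of_nat_Suc)
  then have "exp 1 \<le> exp (real (Suc k) * ln (real (Suc k) / real k))" by simp
  also have "\<dots> = (real (Suc k) / real k) ^ Suc k"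
    using Suc by (subst exp_of_nat_mult) (simp del: power_Suc)
  finally have e: "exp 1 * real k ^ Suc k \<le> real (Suc k) ^ Suc k"
    using Suc by (simp add: power_divide field_simps del: power_Suc of_nat_Suc)
  have "fact (Suc k) = real (Suc k) * fact k" by simp
  also have "\<dots> \<le> real (Suc k) * (real k ^ (k + 1) * exp (1 - real k))"
    using Suc by (intro mult_left_mono) auto
  also have "\<dots> = real (Suc k) * exp (- real k) * (exp 1 * real k ^ Suc k)"
    by (simp add: exp_diff exp_minus field_simps)
  also have "\<dots> \<le> real (Suc k) * exp (- real k) * real (Suc k) ^ Suc k"
    by (intro mult_left_mono e) auto
  finally show ?case by (simp add: mult_ac)
qed simp

text \<open>The mean will be random and known only to lie near \<gamma>, hence the uniformity in
  \<open>x\<close>. It is obtained by monotonicity: \<open>x\<close> is replaced by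
  \<open>\<gamma> - \<delta>\<close> in the power and by \<open>\<gamma> + \<delta>\<close> in the
  exponential.\<close>

lemma pois_lower_bound:
  assumes "0 \<le> \<gamma>" "ell \<gamma> a = ereal u" "0 < \<epsilon>"
  obtains \<delta> where "0 < \<delta>"
    "\<forall>\<^sub>F n in sequentially. \<forall>x. 0 \<le> x \<longrightarrow> \<bar>x - \<gamma>\<bar> < \<delta> \<longrightarrow>
       exp (- real n * (u + \<epsilon>)) \<le> pois (real n * x) (nat \<lfloor>real n * a\<rfloor>)"
proof -
  consider "a = 0" "u = \<gamma>" | "0 < a" "0 < \<gamma>" "u = \<gamma> - a + a * ln (a / \<gamma>)"
    using assms by (fastforce simp: ell_def split: if_splits)
  then show thesis
  proof cases
    case 1
    show thesis
    proof (rule that[OF \<open>0 < \<epsilon>\<close>], intro eventuallyI allI impI)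
      fix n x assume "0 \<le> x" "\<bar>x - \<gamma>\<bar> < \<epsilon>"
      then have "real n * x \<le> real n * (u + \<epsilon>)" using 1 by (intro mult_left_mono) auto
      then show "exp (- real n * (u + \<epsilon>)) \<le> pois (real n * x) (nat \<lfloor>real n * a\<rfloor>)"
        using 1 by (simp add: pois_def)
    qed
  next
    case 2
    \<comment> \<open>The limiting exponent after that replacement; it is continuous at 0 with value
      \<open>u\<close>, so a small \<delta> costs less than \<epsilon>.\<close>
    define g where "g \<delta> = (\<gamma> + \<delta>) - a * ln (\<gamma> - \<delta>) + a * ln a - a" for \<delta>
    have "(g \<longlongrightarrow> g 0) (at_right 0)" unfolding g_def using 2 by (intro tendsto_intros) auto
    moreover have "g 0 = u" using 2 by (simp add: g_def ln_div algebra_simps)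
    ultimately have "\<forall>\<^sub>F \<delta> in at_right 0. g \<delta> < u + \<epsilon>"
      using \<open>0 < \<epsilon>\<close> by (auto intro: order_tendstoD(2))
    moreover have "\<forall>\<^sub>F \<delta> in at_right 0. \<delta> < \<gamma>" "\<forall>\<^sub>F \<delta> in at_right 0. (0::real) < \<delta>"
      using 2 by (auto simp: eventually_at_right_less eventually_at_right[of 0 1] intro!: exI[of _ \<gamma>])
    ultimately have "\<forall>\<^sub>F \<delta> in at_right 0. g \<delta> < u + \<epsilon> \<and> \<delta> < \<gamma> \<and> 0 < \<delta>"
      by eventually_elim simp
    then obtain \<delta> where \<delta>: "g \<delta> < u + \<epsilon>" "\<delta> < \<gamma>" "0 < \<delta>"
      by (metis (no_types, lifting) eventually_happens trivial_limit_at_right_real)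
    \<comment> \<open>Minus \<open>1/n\<close> times the logarithm of the lower bound at
      \<open>k = \<lfloor>n * a\<rfloor>\<close>, with the factorial replaced by its upper
      bound.\<close>
    define h where "h n = (\<gamma> + \<delta>) - (of_int \<lfloor>real n * a\<rfloor> / real n) * (ln (real n) + ln (\<gamma> - \<delta>))
        + ((of_int \<lfloor>real n * a\<rfloor> + 1) * ln (of_int \<lfloor>real n * a\<rfloor>) + 1 - of_int \<lfloor>real n * a\<rfloor>) / real n" for n
    have "h \<longlonglongrightarrow> g \<delta>" unfolding g_def h_def using 2 by real_asymp
    then have "\<forall>\<^sub>F n in sequentially. h n < u + \<epsilon>" using \<delta> by (intro order_tendstoD(2))
    moreover have "\<forall>\<^sub>F n in sequentially. 1 \<le> real n * a" using 2 by real_asymp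
    ultimately have "\<forall>\<^sub>F n in sequentially. \<forall>x. 0 \<le> x \<longrightarrow> \<bar>x - \<gamma>\<bar> < \<delta> \<longrightarrow>
       exp (- real n * (u + \<epsilon>)) \<le> pois (real n * x) (nat \<lfloor>real n * a\<rfloor>)"
      using eventually_gt_at_top[of 0]
    proof eventually_elim
      case (elim n)
      define k where "k = nat \<lfloor>real n * a\<rfloor>"
      have k: "0 < k" "of_int \<lfloor>real n * a\<rfloor> = real k" using elim(2) by (auto simp: k_def)
      show ?case
      proof (intro allI impI)
        fix x assume x: "0 \<le> x" "\<bar>x - \<gamma>\<bar> < \<delta>"
        let ?p = "real n * (\<gamma> - \<delta>)"
        have p: "0 < ?p" using \<delta> elim by simp
        have "ln ?p = ln n + ln (\<gamma> - \<delta>)" using elim \<delta> by (simp add: ln_mult)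
        then have "n * h n = n * (\<gamma> + \<delta>) - k * ln ?p + ((real k + 1) * ln k + (1 - real k))"
          using elim(3) unfolding h_def k by (simp add: field_simps)
        then have "- (n * h n) = (k * ln ?p - ((real k + 1) * ln k + (1 - real k))) + - (n * (\<gamma> + \<delta>))"
          by linarith
        then have "exp (- (n * h n)) = exp (k * ln ?p) / (exp ((real k + 1) * ln k) * exp (1 - real k)) * exp (- (n * (\<gamma> + \<delta>)))"
          by (simp only: exp_add exp_diff)
        also have "\<dots> = ?p ^ k / (real k ^ (k + 1) * exp (1 - real k)) * exp (- (n * (\<gamma> + \<delta>)))"
        proof -
          have "exp (k * ln ?p) = ?p ^ k" using p by (simp only: exp_of_nat_mult exp_ln)
          moreover have "exp ((real k + 1) * ln k) = real k ^ (k + 1)"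
            using k(1) exp_of_nat_mult[of "k + 1" "ln (real k)"] by (simp add: add.commute)
          ultimately show ?thesis by (simp only:)
        qed
        also have "\<dots> \<le> (real n * x) ^ k / fact k * exp (- (n * x))"
        proof (intro mult_mono frac_le power_mono fact_le_power_exp k)
          show "exp (- (real n * (\<gamma> + \<delta>))) \<le> exp (- (real n * x))" using x by (simp add: mult_left_mono)
        qed (use x p k elim \<delta> in \<open>auto intro!: mult_left_mono divide_nonneg_nonneg mult_nonneg_nonneg\<close>)
        finally have "exp (- (n * h n)) \<le> pois (real n * x) k" by (simp add: pois_def)
        moreover have "exp (- real n * (u + \<epsilon>)) \<le> exp (- (n * h n))"
          using elim(1) by (simp add: mult_left_mono)
        ultimately show "exp (- real n * (u + \<epsilon>)) \<le> pois (real n * x) (nat \<lfloor>real n * a\<rfloor>)"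
          unfolding k_def by linarith
      qed
    qed
    with \<delta>(3) show thesis by (rule that)
  qed
qed

section \<open>Mixed Poisson probabilities and the logarithmic scale\<close>

lemma pois_set_borel_measurable [measurable]: "pois_set S \<in> borel_measurable borel"
  unfolding pois_set_def pois_def by measurable

lemma (in prob_space) mixed_poisson_prob:
  assumes X[measurable]: "X \<in> measurable M (count_space UNIV)"
    and P[measurable]: "\<Phi> \<in> borel_measurable M" and nn: "\<And>\<omega>. \<omega> \<in> space M \<Longrightarrow> 0 \<le> \<Phi> \<omega>"
    and pmf: "\<And>k::nat. prob {\<omega> \<in> space M. X \<omega> = k} = (\<integral>\<omega>. pois (\<Phi> \<omega>) k \<partial>M)"
  shows "prob {\<omega> \<in> space M. X \<omega> \<in> S} = (\<integral>\<omega>. pois_set S (\<Phi> \<omega>) \<partial>M)"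
proof -
  have [measurable]: "(\<lambda>\<omega>. pois (\<Phi> \<omega>) k) \<in> borel_measurable M" for k
    unfolding pois_def by measurable
  have int: "integrable M (\<lambda>\<omega>. pois (\<Phi> \<omega>) k)" for k
    by (rule integrable_const_bound[where B=1]) (auto simp: nn pois_nonneg pois_le_1)
  have int2: "integrable M (\<lambda>\<omega>. pois_set S (\<Phi> \<omega>))"
    by (rule integrable_const_bound[where B=1]) (auto simp: nn pois_set_nonneg pois_set_le_1)
  have "emeasure M {\<omega> \<in> space M. X \<omega> \<in> S} = emeasure M (\<Union>k. if k \<in> S then {\<omega> \<in> space M. X \<omega> = k} else {})"
    by (rule arg_cong[where f="emeasure M"]) (auto split: if_splits)
  also have "\<dots> = (\<Sum>k. emeasure M (if k \<in> S then {\<omega> \<in> space M. X \<omega> = k} else {}))"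
    by (rule suminf_emeasure[symmetric]) (auto simp: disjoint_family_on_def split: if_splits)
  also have "\<dots> = (\<Sum>k. \<integral>\<^sup>+\<omega>. ennreal (if k \<in> S then pois (\<Phi> \<omega>) k else 0) \<partial>M)"
    by (intro suminf_cong)
       (auto simp: emeasure_eq_measure pmf nn_integral_eq_integral[OF int] nn pois_nonneg)
  also have "\<dots> = (\<integral>\<^sup>+\<omega>. (\<Sum>k. ennreal (if k \<in> S then pois (\<Phi> \<omega>) k else 0)) \<partial>M)"
    by (rule nn_integral_suminf[symmetric]) measurable
  also have "\<dots> = (\<integral>\<^sup>+\<omega>. ennreal (pois_set S (\<Phi> \<omega>)) \<partial>M)"
    unfolding pois_set_def
    by (intro nn_integral_cong suminf_ennreal2 summable_pois_set) (auto simp: nn pois_nonneg)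
  also have "\<dots> = ennreal (\<integral>\<omega>. pois_set S (\<Phi> \<omega>) \<partial>M)"
    by (rule nn_integral_eq_integral[OF int2]) (auto simp: nn pois_set_nonneg)
  finally show ?thesis
    by (simp add: emeasure_eq_measure integral_nonneg_AE nn pois_set_nonneg)
qed

lemma nlog_le: assumes "0 < n" "0 \<le> p" "p \<le> exp (- real n * c)" shows "nlog n p \<le> ereal (- c)"
proof (cases "p = 0")
  case False
  then have "ln p \<le> - real n * c" using assms ln_mono[of p "exp (- real n * c)"] by simp
  then show ?thesis using assms False by (simp add: nlog_def field_simps)
qed (simp add: nlog_def)

lemma le_nlog: assumes "0 < n" "exp (- real n * c) \<le> p" shows "ereal (- c) \<le> nlog n p"
proof -
  have p: "0 < p" using assms(2) exp_gt_zero by (rule less_le_trans[rotated])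
  then have "- real n * c \<le> ln p" using assms by (simp add: ln_ge_iff)
  then show ?thesis using assms p by (simp add: nlog_def field_simps)
qed

lemma exp_le_of_nlog: assumes "0 < n" "0 \<le> p" "ereal (- c) \<le> nlog n p" shows "exp (- real n * c) \<le> p"
proof -
  have p: "0 < p" using assms by (cases "p = 0") (auto simp: nlog_def)
  then have "- real n * c \<le> ln p" using assms by (simp add: nlog_def field_simps)
  then show ?thesis using p by (simp add: ln_ge_iff)
qed

lemma le_exp_of_nlog: assumes "0 < n" "0 \<le> p" "nlog n p \<le> ereal (- c)" shows "p \<le> exp (- real n * c)"
proof (cases "p = 0")
  case False
  then have "ln p \<le> - real n * c" using assms by (simp add: nlog_def field_simps)
  then have "exp (ln p) \<le> exp (- real n * c)" by (subst exp_le_cancel_iff)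
  then show ?thesis using False assms by simp
qed simp

section \<open>Large deviations of mixed Poisson variables\<close>

lemma
  assumes "LDP \<nu> \<rho>"
  shows LDP_nonneg: "0 \<le> \<rho> x" and LDP_closed_level: "closed {x. \<rho> x \<le> c}"
    and LDP_upper: "closed F \<Longrightarrow> limsup (\<lambda>n. nlog n (measure (\<nu> n) F)) \<le> - (INF x\<in>F. \<rho> x)"
    and LDP_lower: "open G \<Longrightarrow> - (INF x\<in>G. \<rho> x) \<le> liminf (\<lambda>n. nlog n (measure (\<nu> n) G))"
  using assms by (auto simp: LDP_def)

text \<open>Lower semicontinuity of the new rate function. When \<open>a\<close> and
  \<open>ell \<gamma> a\<close> are bounded, so is \<gamma>; near-minimisers thus have a convergent
  subsequence although the level sets of \<psi> need not be compact.\<close>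

lemma closed_inf_ell_le:
  assumes psi_nn: "\<And>x. 0 \<le> \<psi> x" and psi_closed: "\<And>c. closed {x. \<psi> x \<le> c}"
    and R_nn: "\<And>\<gamma>. \<gamma> \<in> R \<Longrightarrow> 0 \<le> \<gamma>" and R: "\<And>\<gamma>. \<psi> \<gamma> < \<infinity> \<Longrightarrow> \<gamma> \<in> R"
  shows "closed {a. (INF \<gamma>\<in>R. ell \<gamma> a + \<psi> \<gamma>) \<le> (c::ereal)}"
proof (cases c)
  case PInf
  then show ?thesis by simp
next
  case MInf
  have "\<And>a. 0 \<le> (INF \<gamma>\<in>R. ell \<gamma> a + \<psi> \<gamma>)"
    by (intro INF_greatest add_nonneg_nonneg ell_nonneg R_nn psi_nn)
  then have "{a. (INF \<gamma>\<in>R. ell \<gamma> a + \<psi> \<gamma>) \<le> c} = {}"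
    using MInf by (auto simp: not_le intro: less_le_trans[of _ 0])
  then show ?thesis by simp
next
  case (real u)
  show ?thesis unfolding closed_sequential_limits
  proof (intro allI impI)
    fix a b assume *: "(\<forall>n. a n \<in> {a. (INF \<gamma>\<in>R. ell \<gamma> a + \<psi> \<gamma>) \<le> c}) \<and> a \<longlonglongrightarrow> b"
    \<comment> \<open>Near-minimisers only: the infimum over \<open>R\<close> is not known to be
      attained.\<close>
    have "\<exists>\<gamma>\<in>R. ell \<gamma> (a n) + \<psi> \<gamma> < ereal (u + 1 / real (Suc n))" for n
    proof -
      have "(INF \<gamma>\<in>R. ell \<gamma> (a n) + \<psi> \<gamma>) \<le> ereal u" using * real by simp
      also have "\<dots> < ereal (u + 1 / real (Suc n))" by simp
      finally show ?thesis by (simp add: INF_less_iff)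
    qed
    then obtain x where x: "\<And>n. x n \<in> R" "\<And>n. ell (x n) (a n) + \<psi> (x n) < ereal (u + 1 / real (Suc n))"
      by metis
    have x0: "0 \<le> x n" for n using x R_nn by auto
    \<comment> \<open>Eliminating \<open>ell\<close> by duality leaves bounds on \<psi> alone, one
      for each \<theta>. Their limit needs only the closed level sets of \<psi>, and quantifying
      over \<theta> restores \<open>ell\<close> at the limit point.\<close>
    have key: "\<psi> (x n) \<le> ereal (u + 1 / real (Suc n) - (\<theta> * a n - x n * (exp \<theta> - 1)))" for n \<theta>
    proof -
      obtain p where p: "\<psi> (x n) = ereal p" "0 \<le> p"
        using x(2)[of n] psi_nn[of "x n"] ell_nonneg[OF x0[of n], of "a n"] by (cases "\<psi> (x n)") auto
      then have "ell (x n) (a n) \<le> ereal (u + 1 / real (Suc n) - p)"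
        using x(2)[of n] by (cases "ell (x n) (a n)") auto
      then have "\<theta> * a n - x n * (exp \<theta> - 1) \<le> u + 1 / real (Suc n) - p"
        using x0 by (simp add: ell_le_iff)
      then show ?thesis using p by simp
    qed
    obtain B where B: "\<And>n. \<bar>a n\<bar> \<le> B"
      using convergent_imp_Bseq[of a] * by (auto simp: convergent_def Bseq_def)
    have "bounded (range x)"
      unfolding bounded_iff
    proof (intro exI ballI, safe)
      fix n
      have "ell (x n) (a n) \<le> ell (x n) (a n) + \<psi> (x n)" using psi_nn[of "x n"]
        by (metis add.right_neutral add_left_mono)
      also have "\<dots> \<le> ereal (u + 1)" using less_le_trans[OF x(2)[of n], of "ereal (u + 1)"] by simp
      finally have "x n \<le> 2 * (u + 1 + a n)" by (rule ell_le_bounds(3)[OF x0])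
      then show "norm (x n) \<le> 2 * (u + 1 + B)" using B[of n] x0[of n] by simp
    qed
    then obtain g r where r: "strict_mono (r::nat\<Rightarrow>nat)" "(x \<circ> r) \<longlonglongrightarrow> g"
      using bounded_imp_convergent_subsequence by blast
    have xr: "(\<lambda>n. x (r n)) \<longlonglongrightarrow> g" using r(2) by (simp add: o_def)
    have ar: "(\<lambda>n. a (r n)) \<longlonglongrightarrow> b" using LIMSEQ_subseq_LIMSEQ[OF conjunct2[OF *] r(1)] by (simp add: o_def)
    have ur: "(\<lambda>n. 1 / real (Suc (r n))) \<longlonglongrightarrow> 0"
      using LIMSEQ_subseq_LIMSEQ[OF LIMSEQ_Suc[OF lim_1_over_n] r(1)] by (simp add: o_def)
    have g: "0 \<le> g" using xr x0 by (auto intro: LIMSEQ_le_const)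
    have psig: "\<psi> g \<le> ereal (u - (\<theta> * b - g * (exp \<theta> - 1)))" for \<theta>
    proof (rule ereal_le_epsilon2)
      fix e :: real assume e: "0 < e"
      let ?w = "u - (\<theta> * b - g * (exp \<theta> - 1))"
      have "(\<lambda>n. u + 1 / real (Suc (r n)) - (\<theta> * a (r n) - x (r n) * (exp \<theta> - 1))) \<longlonglongrightarrow> u + 0 - (\<theta> * b - g * (exp \<theta> - 1))"
        by (intro tendsto_intros xr ar ur)
      then have "\<forall>\<^sub>F n in sequentially. u + 1 / real (Suc (r n)) - (\<theta> * a (r n) - x (r n) * (exp \<theta> - 1)) < ?w + e"
        using e by (intro order_tendstoD(2)) auto
      then have "\<forall>\<^sub>F n in sequentially. x (r n) \<in> {x. \<psi> x \<le> ereal (?w + e)}"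
      proof eventually_elim
        case (elim n)
        then show ?case using order_trans[OF key[of "r n" \<theta>]] by simp
      qed
      then have "g \<in> {x. \<psi> x \<le> ereal (?w + e)}"
        by (intro Lim_in_closed_set[OF psi_closed _ _ xr]) auto
      then show "\<psi> g \<le> ereal ?w + ereal e" by simp
    qed
    \<comment> \<open>At \<theta> = 0 the bound reads \<open>\<psi> g \<le> u\<close>, so \<psi> is
      finite at \<open>g\<close>.\<close>
    have "g \<in> R" by (rule R, rule le_less_trans[OF psig[of 0]]) simp
    obtain p where p: "\<psi> g = ereal p" using psig[of 0] psi_nn[of g] by (cases "\<psi> g") auto
    have "ell g b \<le> ereal (u - p)" unfolding ell_le_iff[OF g] using psig p by (simp add: algebra_simps)
    then have "ell g b + \<psi> g \<le> ereal u" using p by (cases "ell g b") auto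
    then have "(INF \<gamma>\<in>R. ell \<gamma> b + \<psi> \<gamma>) \<le> ereal u" by (rule INF_lower2[OF \<open>g \<in> R\<close>])
    then show "b \<in> {a. (INF \<gamma>\<in>R. ell \<gamma> a + \<psi> \<gamma>) \<le> c}" using real by simp
  qed
qed

text \<open>The half-line is covered by finitely many sets on each of which \<open>inf (ell \<gamma> ` F)\<close> is nearly
  constant; they are closed because this infimum is continuous in \<open>\<gamma>\<close>, which replaces the usual
  compactness of level sets.\<close>

lemma mixed_poisson_upper_bound:
  fixes M :: "nat \<Rightarrow> 'a measure"
  assumes ps: "\<And>n. prob_space (M n)"
    and [measurable]: "\<And>n. X n \<in> measurable (M n) (count_space UNIV)"
    and [measurable]: "\<And>n. \<Phi> n \<in> borel_measurable (M n)"
    and nn: "\<And>n \<omega>. \<omega> \<in> space (M n) \<Longrightarrow> 0 \<le> \<Phi> n \<omega>"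
    and pmf: "\<And>n k. measure (M n) {\<omega> \<in> space (M n). X n \<omega> = k} = (\<integral>\<omega>. pois (real n * \<Phi> n \<omega>) k \<partial>M n)"
    and LDP: "LDP (\<lambda>n. distr (M n) borel (\<Phi> n)) \<psi>"
    and F: "closed F"
    and V: "\<And>\<gamma> a. 0 \<le> \<gamma> \<Longrightarrow> a \<in> F \<Longrightarrow> V \<le> ell \<gamma> a + \<psi> \<gamma>"
  shows "limsup (\<lambda>n. nlog n (measure (M n) {\<omega> \<in> space (M n). real (X n \<omega>) / real n \<in> F})) \<le> - V"
proof -
  let ?P = "\<lambda>n. measure (M n) {\<omega> \<in> space (M n). real (X n \<omega>) / real n \<in> F}"
  let ?\<nu> = "\<lambda>n C. measure (M n) {\<omega> \<in> space (M n). \<Phi> n \<omega> \<in> C}"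
  have \<nu>: "measure (distr (M n) borel (\<Phi> n)) C = ?\<nu> n C" if "C \<in> sets borel" for n C
    using that by (subst measure_distr) (auto intro!: arg_cong[where f="measure (M n)"])
  have P: "?P n = (\<integral>\<omega>. pois_set {k. real k / real n \<in> F} (real n * \<Phi> n \<omega>) \<partial>M n)" for n
    using prob_space.mixed_poisson_prob[OF ps, of "X n" n "\<lambda>\<omega>. real n * \<Phi> n \<omega>" "{k. real k / real n \<in> F}"]
    by (simp add: pmf nn)
  \<comment> \<open>Finite positive levels below \<open>V\<close> also treat
    \<open>V = \<infinity>\<close>; they increase to \<open>V\<close> at the end.\<close>
  have *: "limsup (\<lambda>n. nlog n (?P n)) \<le> - ereal v" if v: "ereal v < V" "0 < v" for v
  proof (rule ereal_le_epsilon2)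
    fix e :: real assume e: "0 < e"
    \<comment> \<open>The slices have width \<open>d = v / K < e / 4\<close>. Three losses of
      \<open>d\<close> occur: the width of a slice, the strict inequality extracted from the limsup,
      and the constant \<open>2 * (K + 1)\<close>.\<close>
    obtain K :: nat where K: "4 * v / e < real K" using reals_Archimedean2 by blast
    moreover have "0 < 4 * v / e" using v e by simp
    ultimately have K0: "0 < K" by (metis less_trans of_nat_0_less_iff)
    define d where "d = v / real K"
    have d: "0 < d" "4 * d < e" "real K * d = v" using K0 K v e by (auto simp: d_def field_simps)
    \<comment> \<open>On slice \<open>i\<close> the infimum of \<open>ell \<gamma>\<close> over
      \<open>F\<close> lies between \<open>i * d\<close> and \<open>(i + 1) * d\<close>. Closedness
      of the slices is what the LDP upper bound asks for.\<close>
    define C where "C i = {\<gamma>. 0 \<le> \<gamma> \<and> (\<forall>a\<in>F. ereal (real i * d) \<le> ell \<gamma> a)} \<inter>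
        {\<gamma>. 0 \<le> \<gamma> \<and> (\<exists>a\<in>F. ell \<gamma> a \<le> ereal (real (Suc i) * d))}" for i
    have C: "closed (C i)" for i
    proof -
      have "{\<gamma>. 0 \<le> \<gamma> \<and> (\<forall>a\<in>F. ereal (real i * d) \<le> ell \<gamma> a)} =
          {0..} \<inter> (\<Inter>a\<in>F. {\<gamma>. 0 \<le> \<gamma> \<and> ereal (real i * d) \<le> ell \<gamma> a})" by auto
      also have "closed \<dots>" by (intro closed_Int closed_INT ballI closed_ell_ge) auto
      finally show ?thesis unfolding C_def by (intro closed_Int closed_ell_le_proj F)
    qed
    have [measurable]: "C i \<in> sets borel" for i using C by (rule borel_closed)
    \<comment> \<open>Where no slice applies, the infimum is at least \<open>v\<close> and the
      Poisson bound alone suffices, so finitely many slices do.\<close>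
    have cover: "(\<exists>i<K. \<gamma> \<in> C i) \<or> (\<forall>a\<in>F. ereal v \<le> ell \<gamma> a)" if \<gamma>: "0 \<le> \<gamma>" for \<gamma>
    proof (cases "\<forall>a\<in>F. ereal v \<le> ell \<gamma> a")
      case False
      let ?Q = "\<lambda>i. \<exists>a\<in>F. ell \<gamma> a \<le> ereal (real (Suc i) * d)"
      have ex: "?Q (K - 1)" using False K0 d(3) by (auto simp: not_le intro: less_imp_le)
      define i where "i = (LEAST i. ?Q i)"
      have i: "?Q i" "i \<le> K - 1" unfolding i_def using ex by (rule LeastI, rule Least_le)
      have "ereal (real i * d) \<le> ell \<gamma> a" if "a \<in> F" for a
      proof (cases i)
        case 0
        then show ?thesis using ell_nonneg[OF \<gamma>] by (simp flip: zero_ereal_def)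
      next
        case (Suc j)
        then have "\<not> ?Q j" unfolding i_def by (intro not_less_Least) simp
        then show ?thesis using that Suc by (auto simp: not_le intro: less_imp_le)
      qed
      then show ?thesis using i K0 \<gamma> by (intro disjI1 exI[of _ i]) (auto simp: C_def)
    qed simp
    \<comment> \<open>On slice \<open>i\<close> some \<open>a \<in> F\<close> uses up at most
      \<open>(i + 1) * d\<close> of the total \<open>v\<close>; \<psi> must account for the
      rest.\<close>
    have psiC: "ereal (v - real (Suc i) * d) \<le> (INF x\<in>C i. \<psi> x)" for i
    proof (rule INF_greatest)
      fix \<gamma> assume "\<gamma> \<in> C i"
      then obtain a where a: "0 \<le> \<gamma>" "a \<in> F" "ell \<gamma> a \<le> ereal (real (Suc i) * d)" by (auto simp: C_def)
      have "ereal v \<le> ell \<gamma> a + \<psi> \<gamma>" using V[OF a(1,2)] v(1) by auto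
      also have "\<dots> \<le> ereal (real (Suc i) * d) + \<psi> \<gamma>" using a by (intro add_right_mono)
      finally show "ereal (v - real (Suc i) * d) \<le> \<psi> \<gamma>" by (cases "\<psi> \<gamma>") auto
    qed
    have "\<forall>\<^sub>F n in sequentially. ?\<nu> n (C i) \<le> exp (- real n * (v - real (i + 2) * d))" for i
    proof -
      have "limsup (\<lambda>n. nlog n (?\<nu> n (C i))) \<le> - (INF x\<in>C i. \<psi> x)"
        using LDP_upper[OF LDP C] by (simp add: \<nu>)
      also have "\<dots> \<le> - ereal (v - real (Suc i) * d)" using psiC[of i] by (simp only: ereal_minus_le_minus)
      also have "\<dots> < ereal (- (v - real (i + 2) * d))" using d by (simp add: algebra_simps)
      finally have "\<forall>\<^sub>F n in sequentially. nlog n (?\<nu> n (C i)) < ereal (- (v - real (i + 2) * d))"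
        by (rule Limsup_lessD)
      then show ?thesis using eventually_gt_at_top[of 0]
        by eventually_elim (intro le_exp_of_nlog measure_nonneg less_imp_le)
    qed
    then have "\<forall>\<^sub>F n in sequentially. \<forall>i\<in>{..<K}. ?\<nu> n (C i) \<le> exp (- real n * (v - real (i + 2) * d))"
      by (intro eventually_ball_finite) auto
    moreover have "\<forall>\<^sub>F n in sequentially. 2 * (real K + 1) \<le> exp (real n * d)"
      using d(1) by real_asymp
    ultimately have "\<forall>\<^sub>F n in sequentially. nlog n (?P n) \<le> ereal (- (v - 3 * d))"
      using eventually_gt_at_top[of 0]
    proof eventually_elim
      case (elim n)
      interpret prob_space "M n" by (rule ps)
      have "?P n \<le> (\<integral>\<omega>. (\<Sum>i<K. 2 * exp (- real n * (real i * d)) * indicator {\<omega> \<in> space (M n). \<Phi> n \<omega> \<in> C i} \<omega>)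
            + 2 * exp (- real n * v) \<partial>M n)"
        unfolding P
      proof (rule integral_mono)
        show "integrable (M n) (\<lambda>\<omega>. pois_set {k. real k / real n \<in> F} (real n * \<Phi> n \<omega>))"
          by (rule integrable_const_bound[where B=1]) (auto simp: nn pois_set_nonneg pois_set_le_1)
        show "integrable (M n) (\<lambda>\<omega>. (\<Sum>i<K. 2 * exp (- real n * (real i * d)) * indicator {\<omega> \<in> space (M n). \<Phi> n \<omega> \<in> C i} \<omega>)
            + 2 * exp (- real n * v))"
          by (intro Bochner_Integration.integrable_add Bochner_Integration.integrable_sum integrable_mult_right integrable_real_indicator)
            (auto simp: emeasure_eq_measure)
        fix \<omega> assume \<omega>: "\<omega> \<in> space (M n)"
        let ?p = "pois_set {k. real k / real n \<in> F} (real n * \<Phi> n \<omega>)"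
        let ?s = "\<lambda>i. 2 * exp (- real n * (real i * d)) * indicator {\<omega> \<in> space (M n). \<Phi> n \<omega> \<in> C i} \<omega>"
        show "?p \<le> (\<Sum>i<K. ?s i) + 2 * exp (- real n * v)"
          using cover[OF nn[OF \<omega>]]
        proof
          assume "\<exists>i<K. \<Phi> n \<omega> \<in> C i"
          then obtain i where i: "i < K" "\<Phi> n \<omega> \<in> C i" by auto
          have "?p \<le> 2 * exp (- real n * (real i * d))"
            using i by (intro pois_set_closed_le elim nn \<omega> F) (auto simp: C_def)
          also have "\<dots> = ?s i" using i \<omega> by simp
          also have "\<dots> \<le> (\<Sum>i<K. ?s i)" using i by (intro member_le_sum) auto
          finally show ?thesis by (rule order_trans) simp
        next
          assume "\<forall>a\<in>F. ereal v \<le> ell (\<Phi> n \<omega>) a"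
          then have "?p \<le> 2 * exp (- real n * v)"
            by (intro pois_set_closed_le elim nn \<omega> F) auto
          also have "\<dots> \<le> (\<Sum>i<K. ?s i) + 2 * exp (- real n * v)"
            by (simp add: sum_nonneg)
          finally show ?thesis .
        qed
      qed
      also have "\<dots> = (\<Sum>i<K. 2 * exp (- real n * (real i * d)) * ?\<nu> n (C i)) + 2 * exp (- real n * v)"
      proof -
        define f where "f i \<omega> = 2 * exp (- real n * (real i * d)) * indicator {\<omega> \<in> space (M n). \<Phi> n \<omega> \<in> C i} \<omega>" for i \<omega>
        have "integrable (M n) (f i)" for i unfolding f_def
          by (intro integrable_mult_right integrable_real_indicator) (auto simp: emeasure_eq_measure)
        moreover have "integral\<^sup>L (M n) (f i) = 2 * exp (- real n * (real i * d)) * ?\<nu> n (C i)" for i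
          unfolding f_def by simp
        ultimately show ?thesis unfolding f_def[symmetric] by (simp add: prob_space)
      qed
      also have "\<dots> \<le> (\<Sum>i<K. 2 * exp (- real n * (v - 2 * d))) + 2 * exp (- real n * (v - 2 * d))"
      proof (intro add_mono sum_mono)
        fix i assume "i \<in> {..<K}"
        then have "2 * exp (- real n * (real i * d)) * ?\<nu> n (C i) \<le>
            2 * exp (- real n * (real i * d)) * exp (- real n * (v - real (i + 2) * d))"
          using elim by (intro mult_left_mono) auto
        also have "\<dots> = 2 * exp (- real n * (v - 2 * d))" by (simp add: exp_add[symmetric] algebra_simps)
        finally show "2 * exp (- real n * (real i * d)) * ?\<nu> n (C i) \<le> 2 * exp (- real n * (v - 2 * d))" .
      next
        have "0 \<le> real n * d" using d by simp
        then show "2 * exp (- real n * v) \<le> 2 * exp (- real n * (v - 2 * d))"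
          by (simp add: algebra_simps)
      qed
      also have "\<dots> = 2 * (real K + 1) * exp (- real n * (v - 2 * d))" by (simp add: algebra_simps)
      also have "\<dots> \<le> exp (real n * d) * exp (- real n * (v - 2 * d))"
        using elim by (intro mult_right_mono) auto
      also have "\<dots> = exp (- real n * (v - 3 * d))" by (simp add: exp_add[symmetric] algebra_simps)
      finally show ?case using elim by (intro nlog_le) auto
    qed
    then have "limsup (\<lambda>n. nlog n (?P n)) \<le> ereal (- (v - 3 * d))" by (intro Limsup_bounded)
    also have "\<dots> \<le> - ereal v + ereal e" using d by simp
    finally show "limsup (\<lambda>n. nlog n (?P n)) \<le> - ereal v + ereal e" .
  qed
  show ?thesis
  proof (cases "0 < V")
    case True
    have "V \<le> - limsup (\<lambda>n. nlog n (?P n))"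
    proof (rule dense_le_bounded[OF True])
      fix w assume w: "0 < w" "w < V"
      then obtain v where "w = ereal v" by (cases w) auto
      then have "limsup (\<lambda>n. nlog n (?P n)) \<le> - w" using *[of v] w by simp
      then have "- (- w) \<le> - limsup (\<lambda>n. nlog n (?P n))" by (simp only: ereal_minus_le_minus)
      then show "w \<le> - limsup (\<lambda>n. nlog n (?P n))" by simp
    qed
    then have "- (- limsup (\<lambda>n. nlog n (?P n))) \<le> - V" by (simp only: ereal_minus_le_minus)
    then show ?thesis by simp
  next
    case False
    have "limsup (\<lambda>n. nlog n (?P n)) \<le> ereal (- 0)"
    proof (rule Limsup_bounded, use eventually_gt_at_top[of 0] in eventually_elim)
      fix n :: nat assume "0 < n"
      then show "nlog n (?P n) \<le> ereal (- 0)"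
        using prob_space.prob_le_1[OF ps] by (intro nlog_le) auto
    qed
    also have "\<dots> \<le> - V" using False by (cases V) auto
    finally show ?thesis .
  qed
qed

text \<open>The event is shrunk to the mixing variable lying in a small ball around \<gamma> and the
  count hitting one atom. The LDP bounds the ball, the uniform Poisson estimate bounds the atom on
  the ball, and the exponents add.\<close>

lemma mixed_poisson_lower_bound:
  fixes M :: "nat \<Rightarrow> 'a measure"
  assumes ps: "\<And>n. prob_space (M n)"
    and [measurable]: "\<And>n. X n \<in> measurable (M n) (count_space UNIV)"
    and [measurable]: "\<And>n. \<Phi> n \<in> borel_measurable (M n)"
    and nn: "\<And>n \<omega>. \<omega> \<in> space (M n) \<Longrightarrow> 0 \<le> \<Phi> n \<omega>"
    and pmf: "\<And>n k. measure (M n) {\<omega> \<in> space (M n). X n \<omega> = k} = (\<integral>\<omega>. pois (real n * \<Phi> n \<omega>) k \<partial>M n)"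
    and LDP: "LDP (\<lambda>n. distr (M n) borel (\<Phi> n)) \<psi>"
    and G: "open G" "a \<in> G" and \<gamma>: "0 \<le> \<gamma>"
  shows "- (ell \<gamma> a + \<psi> \<gamma>) \<le> liminf (\<lambda>n. nlog n (measure (M n) {\<omega> \<in> space (M n). real (X n \<omega>) / real n \<in> G}))"
proof -
  let ?P = "\<lambda>n. measure (M n) {\<omega> \<in> space (M n). real (X n \<omega>) / real n \<in> G}"
  let ?\<nu> = "\<lambda>n C. measure (M n) {\<omega> \<in> space (M n). \<Phi> n \<omega> \<in> C}"
  have \<nu>: "measure (distr (M n) borel (\<Phi> n)) C = ?\<nu> n C" if "C \<in> sets borel" for n C
    using that by (subst measure_distr) (auto intro!: arg_cong[where f="measure (M n)"])
  show ?thesis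
  proof (cases "ell \<gamma> a = \<infinity> \<or> \<psi> \<gamma> = \<infinity>")
    case True
    then show ?thesis using ell_nonneg[OF \<gamma>, of a] LDP_nonneg[OF LDP, of \<gamma>] by auto
  next
    case False
    obtain u where u: "ell \<gamma> a = ereal u" using False ell_nonneg[OF \<gamma>, of a] by (cases "ell \<gamma> a") auto
    have "0 \<le> \<psi> \<gamma>" by (rule LDP_nonneg[OF LDP])
    then obtain p where p: "\<psi> \<gamma> = ereal p" using False by (cases "\<psi> \<gamma>") auto
    have a: "0 \<le> a" using ell_le_bounds(1)[OF \<gamma>, of a u] u by simp
    have "- (ell \<gamma> a + \<psi> \<gamma>) \<le> liminf (\<lambda>n. nlog n (?P n)) + ereal e" if e: "0 < e" for e
    proof -
      \<comment> \<open>Half of the allowed loss goes to the atom and half to the ball.\<close>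
      define \<epsilon> where "\<epsilon> = e / 2"
      have \<epsilon>: "0 < \<epsilon>" using e by (simp add: \<epsilon>_def)
      obtain \<delta> where \<delta>: "0 < \<delta>" and low: "\<forall>\<^sub>F n in sequentially. \<forall>x. 0 \<le> x \<longrightarrow> \<bar>x - \<gamma>\<bar> < \<delta> \<longrightarrow>
         exp (- real n * (u + \<epsilon>)) \<le> pois (real n * x) (nat \<lfloor>real n * a\<rfloor>)"
        using pois_lower_bound[OF \<gamma> u \<epsilon>] by blast
      let ?B = "{\<gamma> - \<delta> <..< \<gamma> + \<delta>}"
      have "ereal (- (p + \<epsilon>)) < - \<psi> \<gamma>" using p \<epsilon> by simp
      also have "\<dots> \<le> - (INF x\<in>?B. \<psi> x)" using \<delta> by (subst ereal_minus_le_minus) (auto intro!: INF_lower)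
      also have "\<dots> \<le> liminf (\<lambda>n. nlog n (?\<nu> n ?B))"
        using LDP_lower[OF LDP, of ?B] by (simp add: \<nu>)
      finally have ev1: "\<forall>\<^sub>F n in sequentially. ereal (- (p + \<epsilon>)) < nlog n (?\<nu> n ?B)"
        by (rule less_LiminfD)
      have "(\<lambda>n. real (nat \<lfloor>real n * a\<rfloor>) / real n) \<longlonglongrightarrow> a"
      proof (rule Lim_transform_eventually)
        show "(\<lambda>n. of_int \<lfloor>real n * a\<rfloor> / real n) \<longlonglongrightarrow> a" by real_asymp
        show "\<forall>\<^sub>F n in sequentially. of_int \<lfloor>real n * a\<rfloor> / real n = real (nat \<lfloor>real n * a\<rfloor>) / real n"
          using a by (intro always_eventually) simp
      qed
      then have ev2: "\<forall>\<^sub>F n in sequentially. real (nat \<lfloor>real n * a\<rfloor>) / real n \<in> G"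
        using G by (auto simp: tendsto_def)
      have "\<forall>\<^sub>F n in sequentially. ereal (- (u + p + e)) \<le> nlog n (?P n)"
        using ev1 ev2 low eventually_gt_at_top[of 0]
      proof eventually_elim
        case (elim n)
        interpret prob_space "M n" by (rule ps)
        define k where "k = nat \<lfloor>real n * a\<rfloor>"
        have pm[measurable]: "(\<lambda>\<omega>. pois (real n * \<Phi> n \<omega>) k) \<in> borel_measurable (M n)"
          unfolding pois_def by measurable
        have "exp (- real n * (u + p + e)) = exp (- real n * (u + \<epsilon>)) * exp (- real n * (p + \<epsilon>))"
          by (simp add: exp_add[symmetric] \<epsilon>_def algebra_simps)
        also have "\<dots> \<le> exp (- real n * (u + \<epsilon>)) * ?\<nu> n ?B"
          using elim(1,4) by (intro mult_left_mono exp_le_of_nlog) auto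
        also have "\<dots> = (\<integral>\<omega>. exp (- real n * (u + \<epsilon>)) * indicator {\<omega> \<in> space (M n). \<Phi> n \<omega> \<in> ?B} \<omega> \<partial>M n)"
          by simp
        also have "\<dots> \<le> (\<integral>\<omega>. pois (real n * \<Phi> n \<omega>) k \<partial>M n)"
        proof (rule integral_mono)
          show "integrable (M n) (\<lambda>\<omega>. pois (real n * \<Phi> n \<omega>) k)"
            by (rule integrable_const_bound[where B=1]) (auto simp: nn pois_nonneg pois_le_1)
          show "integrable (M n) (\<lambda>\<omega>. exp (- real n * (u + \<epsilon>)) * indicator {\<omega> \<in> space (M n). \<Phi> n \<omega> \<in> ?B} \<omega>)"
            by (intro integrable_mult_right integrable_real_indicator) (auto simp: emeasure_eq_measure)
          show "exp (- real n * (u + \<epsilon>)) * indicator {\<omega> \<in> space (M n). \<Phi> n \<omega> \<in> ?B} \<omega> \<le> pois (real n * \<Phi> n \<omega>) k"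
            if "\<omega> \<in> space (M n)" for \<omega>
          proof (cases "\<Phi> n \<omega> \<in> ?B")
            case True
            then have "\<bar>\<Phi> n \<omega> - \<gamma>\<bar> < \<delta>" by (auto simp: abs_less_iff)
            then show ?thesis using elim(3)[rule_format, OF nn[OF that]] True that by (simp add: k_def)
          qed (simp add: pois_nonneg nn[OF that])
        qed
        also have "\<dots> = prob {\<omega> \<in> space (M n). X n \<omega> = k}" by (simp add: pmf)
        also have "\<dots> \<le> ?P n" using elim(2) by (intro finite_measure_mono) (auto simp: k_def)
        finally show ?case using elim(4) by (rule le_nlog[rotated])
      qed
      then have "ereal (- (u + p + e)) \<le> liminf (\<lambda>n. nlog n (?P n))" by (rule Liminf_bounded)
      then have "ereal (- (u + p + e)) + ereal e \<le> liminf (\<lambda>n. nlog n (?P n)) + ereal e"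
        by (rule add_right_mono)
      then show ?thesis using u p by simp
    qed
    then show ?thesis by (rule ereal_le_epsilon2)
  qed
qed

theorem LDP_mixed_poisson:
  fixes M :: "nat \<Rightarrow> 'a measure"
  assumes ps: "\<And>n. prob_space (M n)"
    and X[measurable]: "\<And>n. X n \<in> measurable (M n) (count_space UNIV)"
    and \<Phi>[measurable]: "\<And>n. \<Phi> n \<in> borel_measurable (M n)"
    and nn: "\<And>n \<omega>. \<omega> \<in> space (M n) \<Longrightarrow> 0 \<le> \<Phi> n \<omega>"
    and pmf: "\<And>n k. measure (M n) {\<omega> \<in> space (M n). X n \<omega> = k} = (\<integral>\<omega>. pois (real n * \<Phi> n \<omega>) k \<partial>M n)"
    and LDP: "LDP (\<lambda>n. distr (M n) borel (\<Phi> n)) \<psi>"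
    and R: "R = {\<gamma>. 0 \<le> \<gamma> \<and> (\<forall>\<epsilon>>0. \<exists>N. \<forall>n\<ge>N.
        measure (M n) {\<omega> \<in> space (M n). \<Phi> n \<omega> \<in> {\<gamma> - \<epsilon> <..< \<gamma> + \<epsilon>}} > 0)}"
  shows "LDP (\<lambda>n. distr (M n) borel (\<lambda>\<omega>. real (X n \<omega>) / real n)) (\<lambda>a. INF \<gamma>\<in>R. ell \<gamma> a + \<psi> \<gamma>)"
proof -
  let ?P = "\<lambda>n S. measure (M n) {\<omega> \<in> space (M n). real (X n \<omega>) / real n \<in> S}"
  let ?\<nu> = "\<lambda>n C. measure (M n) {\<omega> \<in> space (M n). \<Phi> n \<omega> \<in> C}"
  have \<nu>: "measure (distr (M n) borel (\<Phi> n)) C = ?\<nu> n C" if "C \<in> sets borel" for n C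
    using that by (subst measure_distr) (auto intro!: arg_cong[where f="measure (M n)"])
  have P: "measure (distr (M n) borel (\<lambda>\<omega>. real (X n \<omega>) / real n)) S = ?P n S" if "S \<in> sets borel" for n S
    using that by (subst measure_distr) (auto intro!: arg_cong[where f="measure (M n)"])
  have psi0: "\<And>x. 0 \<le> \<psi> x" by (rule LDP_nonneg[OF LDP])
  \<comment> \<open>A finite value of \<psi> in an open set keeps the liminf above minus infinity,
    and \<open>nlog\<close> is minus infinity exactly at probability 0.\<close>
  have pos: "\<forall>\<^sub>F n in sequentially. 0 < ?\<nu> n B" if "open B" "\<gamma> \<in> B" "\<psi> \<gamma> < \<infinity>" for B \<gamma>
  proof -
    have "- \<infinity> < - \<psi> \<gamma>" using that(3) by (cases "\<psi> \<gamma>") auto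
    also have "\<dots> \<le> - (INF x\<in>B. \<psi> x)" using that by (subst ereal_minus_le_minus) (auto intro!: INF_lower)
    also have "\<dots> \<le> liminf (\<lambda>n. nlog n (?\<nu> n B))"
      using LDP_lower[OF LDP that(1)] that(1) by (simp add: \<nu>)
    finally have "\<forall>\<^sub>F n in sequentially. - \<infinity> < nlog n (?\<nu> n B)"
      by (rule less_LiminfD)
    then show ?thesis by eventually_elim (auto simp: nlog_def zero_less_measure_iff split: if_splits)
  qed
  have dom: "\<gamma> \<in> R" if fin: "\<psi> \<gamma> < \<infinity>" for \<gamma>
  proof -
    \<comment> \<open>Otherwise the negative half-line would eventually have positive mass, against
      nonnegativity of the mixing variable.\<close>
    have "0 \<le> \<gamma>"
    proof (rule ccontr)
      assume "\<not> 0 \<le> \<gamma>"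
      then have "\<forall>\<^sub>F n in sequentially. 0 < ?\<nu> n {..<0}" using fin by (intro pos[of _ \<gamma>]) auto
      moreover have "{\<omega> \<in> space (M n). \<Phi> n \<omega> \<in> {..<0}} = {}" for n using nn by force
      ultimately show False by (simp only: measure_empty) simp
    qed
    moreover have "\<exists>N. \<forall>n\<ge>N. ?\<nu> n {\<gamma> - \<epsilon> <..< \<gamma> + \<epsilon>} > 0" if "\<epsilon> > 0" for \<epsilon>
      using pos[of "{\<gamma> - \<epsilon> <..< \<gamma> + \<epsilon>}" \<gamma>] fin that by (auto simp: eventually_sequentially)
    ultimately show ?thesis unfolding R by blast
  qed
  have Rnn: "\<And>\<gamma>. \<gamma> \<in> R \<Longrightarrow> 0 \<le> \<gamma>" by (simp add: R)
  show ?thesis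
    unfolding LDP_def
  proof (intro conjI allI impI)
    show "0 \<le> (INF \<gamma>\<in>R. ell \<gamma> a + \<psi> \<gamma>)" for a
      by (intro INF_greatest add_nonneg_nonneg ell_nonneg Rnn psi0)
    show "closed {a. (INF \<gamma>\<in>R. ell \<gamma> a + \<psi> \<gamma>) \<le> c}" for c
      by (rule closed_inf_ell_le[OF psi0 LDP_closed_level[OF LDP] Rnn dom])
  next
    fix F :: "real set" assume F: "closed F"
    have "limsup (\<lambda>n. nlog n (?P n F)) \<le> - (INF a\<in>F. INF \<gamma>\<in>R. ell \<gamma> a + \<psi> \<gamma>)"
    proof (rule mixed_poisson_upper_bound[OF ps X \<Phi> nn pmf LDP F])
      fix \<gamma> a :: real assume *: "0 \<le> \<gamma>" "a \<in> F"
      show "(INF a\<in>F. INF \<gamma>\<in>R. ell \<gamma> a + \<psi> \<gamma>) \<le> ell \<gamma> a + \<psi> \<gamma>"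
      proof (cases "\<psi> \<gamma> < \<infinity>")
        case True
        then show ?thesis using * dom by (intro INF_lower2[OF \<open>a \<in> F\<close>] INF_lower)
      next
        case False
        then show ?thesis using ell_nonneg[OF *(1), of a] by (cases "ell \<gamma> a") auto
      qed
    qed
    then show "limsup (\<lambda>n. nlog n (measure (distr (M n) borel (\<lambda>\<omega>. real (X n \<omega>) / real n)) F))
        \<le> - (INF x\<in>F. INF \<gamma>\<in>R. ell \<gamma> x + \<psi> \<gamma>)"
      using F by (simp add: P)
  next
    fix G :: "real set" assume G: "open G"
    have "- liminf (\<lambda>n. nlog n (?P n G)) \<le> (INF a\<in>G. INF \<gamma>\<in>R. ell \<gamma> a + \<psi> \<gamma>)"
    proof (intro INF_greatest)
      fix a \<gamma> assume "a \<in> G" "\<gamma> \<in> R"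
      then show "- liminf (\<lambda>n. nlog n (?P n G)) \<le> ell \<gamma> a + \<psi> \<gamma>"
        by (intro mixed_poisson_lower_bound[OF ps X \<Phi> nn pmf LDP G, THEN ereal_uminus_le_reorder[THEN iffD1]] Rnn)
    qed
    then have "- (INF x\<in>G. INF \<gamma>\<in>R. ell \<gamma> x + \<psi> \<gamma>) \<le> liminf (\<lambda>n. nlog n (?P n G))"
      by (rule ereal_uminus_le_reorder[THEN iffD1])
    then show "- (INF x\<in>G. INF \<gamma>\<in>R. ell \<gamma> x + \<psi> \<gamma>) \<le>
        liminf (\<lambda>n. nlog n (measure (distr (M n) borel (\<lambda>\<omega>. real (X n \<omega>) / real n)) G))"
      using G by (simp add: P)
  qed
qed

section \<open>Right-continuous processes\<close>

lemma cadlag_compose: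
  fixes g :: "'e::t2_space \<Rightarrow> 'f::topological_space"
  assumes "cadlag f" "continuous_on UNIV g"
  shows "cadlag (\<lambda>s. g (f s))"
proof -
  have g: "isCont g x" for x using assms(2) by (simp add: continuous_on_eq_continuous_at)
  show ?thesis using assms(1) unfolding cadlag_def
    by (blast intro: isCont_tendsto_compose[OF g])
qed

text \<open>One-sided limits bound \<open>f\<close> near every point, and compactness leaves
  finitely many neighbourhoods.\<close>

lemma cadlag_bounded:
  fixes f :: "real \<Rightarrow> real"
  assumes "cadlag f"
  obtains B where "\<And>s. s \<in> {0..T} \<Longrightarrow> \<bar>f s\<bar> \<le> B"
proof -
  have loc: "\<exists>U. open U \<and> x \<in> U \<and> (\<exists>B. \<forall>s\<in>U. 0 \<le> s \<longrightarrow> \<bar>f s\<bar> \<le> B)" if x: "0 \<le> x" for x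
  proof -
    have bd: "\<exists>B. \<forall>\<^sub>F s in F. \<bar>f s\<bar> < B" if "(f \<longlongrightarrow> l) F" for l F
      using order_tendstoD(2)[OF tendsto_rabs[OF that], of "\<bar>l\<bar> + 1"] by auto
    obtain B1 where B1: "\<forall>\<^sub>F s in at_right x. \<bar>f s\<bar> < B1"
      using bd assms x unfolding cadlag_def by blast
    \<comment> \<open>The guard \<open>0 \<le> s\<close> makes the left neighbourhood of 0 vacuous;
      no left limit is available there.\<close>
    obtain B2 where B2: "\<forall>\<^sub>F s in at_left x. 0 \<le> s \<longrightarrow> \<bar>f s\<bar> < B2"
    proof (cases "x = 0")
      case True
      have "\<forall>\<^sub>F s in at_left x. 0 \<le> s \<longrightarrow> \<bar>f s\<bar> < 0"
        unfolding eventually_at_filter using True by (auto intro: always_eventually)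
      then show ?thesis by (rule that)
    next
      case False
      then obtain l where "(f \<longlongrightarrow> l) (at_left x)" using assms x unfolding cadlag_def by force
      then obtain B where "\<forall>\<^sub>F s in at_left x. \<bar>f s\<bar> < B" using bd by blast
      then show ?thesis by (intro that[of B]) (auto elim: eventually_mono)
    qed
    let ?B = "max \<bar>f x\<bar> (max B1 B2)"
    have "\<forall>\<^sub>F s in at x. 0 \<le> s \<longrightarrow> \<bar>f s\<bar> \<le> ?B"
      unfolding eventually_at_split
      using B1 B2 by (auto elim!: eventually_mono)
    then obtain U where "open U" "x \<in> U" "\<forall>s\<in>U. s \<noteq> x \<longrightarrow> 0 \<le> s \<longrightarrow> \<bar>f s\<bar> \<le> ?B"
      unfolding eventually_at_topological by auto
    then show ?thesis by (intro exI[of _ U] conjI exI[of _ ?B]) auto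
  qed
  then obtain U B where UB: "\<And>x. 0 \<le> x \<Longrightarrow> open (U x)" "\<And>x. 0 \<le> x \<Longrightarrow> x \<in> U x"
    "\<And>x s. 0 \<le> x \<Longrightarrow> s \<in> U x \<Longrightarrow> 0 \<le> s \<Longrightarrow> \<bar>f s\<bar> \<le> B x"
    by metis
  have "compact {0..T}" by (rule compact_Icc)
  then obtain C where C: "C \<subseteq> {0..T}" "finite C" "{0..T} \<subseteq> (\<Union>c\<in>C. U c)"
    by (rule compactE_image[of _ "{0..T}" U]) (use UB in \<open>auto intro!: bexI\<close>)
  show thesis
  proof (rule that)
    fix s assume s: "s \<in> {0..T}"
    then obtain c where c: "c \<in> C" "s \<in> U c" using C by auto
    have "\<bar>f s\<bar> \<le> B c" using UB(3)[of c s] C c s by auto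
    also have "\<dots> \<le> Max (B ` C)" using C c by (intro Max_ge) auto
    finally show "\<bar>f s\<bar> \<le> Max (B ` C)" .
  qed
qed

section \<open>Approximation of times from the right and measurability\<close>

text \<open>Floor plus one, not ceiling: the result strictly exceeds \<open>x\<close>, so it
  converges along \<open>at_right x\<close> even at mesh points. For fixed \<open>r\<close> it takes
  countably many values.\<close>

definition round_up :: "nat \<Rightarrow> real \<Rightarrow> real" where
  "round_up r x = (real_of_int \<lfloor>x * real (Suc r)\<rfloor> + 1) / real (Suc r)"

lemma round_up_gt: "x < round_up r x"
proof -
  have "x * real (Suc r) < real_of_int \<lfloor>x * real (Suc r)\<rfloor> + 1" by (rule floor_correct[THEN conjunct2, simplified])
  then show ?thesis by (simp add: round_up_def field_simps)
qed

lemma round_up_le: "round_up r x \<le> x + 1 / real (Suc r)"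
proof -
  have "real_of_int \<lfloor>x * real (Suc r)\<rfloor> + 1 \<le> x * real (Suc r) + 1" by simp
  then have "round_up r x \<le> (x * real (Suc r) + 1) / real (Suc r)"
    unfolding round_up_def by (intro divide_right_mono) auto
  also have "\<dots> = x + 1 / real (Suc r)" by (simp add: add_divide_distrib)
  finally show ?thesis .
qed

lemma round_up_mono: "x \<le> y \<Longrightarrow> round_up r x \<le> round_up r y"
  unfolding round_up_def by (intro divide_right_mono add_right_mono) (auto intro!: floor_mono mult_right_mono)

lemma round_up_at_right: "filterlim (\<lambda>r. round_up r x) (at_right x) sequentially"
  unfolding filterlim_at
proof
  show "(\<lambda>r. round_up r x) \<longlonglongrightarrow> x"
  proof (rule tendsto_sandwich[OF _ _ tendsto_const])
    show "(\<lambda>r. x + 1 / real (Suc r)) \<longlonglongrightarrow> x"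
      using tendsto_add[OF tendsto_const LIMSEQ_Suc[OF lim_1_over_n], of x] by simp
  qed (intro always_eventually allI less_imp_le[OF round_up_gt] round_up_le)+
qed (simp add: round_up_gt less_imp_neq[OF round_up_gt, symmetric])

text \<open>A rounded random time has countably many values, so evaluation there is a countable
  patching of fixed-time coordinates.\<close>

lemma measurable_eval_round_up:
  assumes f: "\<And>s. 0 \<le> s \<Longrightarrow> X s \<in> measurable F N" and g[measurable]: "g \<in> borel_measurable F"
    and nn: "\<And>\<omega>. \<omega> \<in> space F \<Longrightarrow> 0 \<le> g \<omega>"
  shows "(\<lambda>\<omega>. X (round_up r (g \<omega>)) \<omega>) \<in> measurable F N"
proof -
  have "(\<lambda>\<omega>. X ((real (nat \<lfloor>g \<omega> * real (Suc r)\<rfloor>) + 1) / real (Suc r)) \<omega>) \<in> measurable F N"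
  proof (rule measurable_compose_countable[where f="\<lambda>i \<omega>. X ((real i + 1) / real (Suc r)) \<omega>"])
    show "(\<lambda>\<omega>. nat \<lfloor>g \<omega> * real (Suc r)\<rfloor>) \<in> measurable F (count_space UNIV)" by measurable
  qed (auto intro: f)
  also have "?this \<longleftrightarrow> ?thesis"
    using nn by (intro measurable_cong) (simp add: round_up_def)
  finally show ?thesis .
qed

text \<open>Local boundedness is listed separately because right-continuity does not imply it; it
  provides integrability and the dominating constants. This class is preserved by products,
  continuous maps and integration in time.\<close>

definition rc_process :: "'a measure \<Rightarrow> (real \<Rightarrow> 'a \<Rightarrow> real) \<Rightarrow> bool" where
  "rc_process F X \<longleftrightarrow> (\<forall>s\<ge>0. X s \<in> borel_measurable F) \<and>
     (\<forall>\<omega>\<in>space F. (\<forall>s\<ge>0. ((\<lambda>s. X s \<omega>) \<longlongrightarrow> X s \<omega>) (at_right s)) \<and> (\<forall>T. \<exists>B. \<forall>s\<in>{0..T}. \<bar>X s \<omega>\<bar> \<le> B))"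

lemma rc_processD:
  assumes "rc_process F X"
  shows "0 \<le> s \<Longrightarrow> X s \<in> borel_measurable F"
    and "0 \<le> s \<Longrightarrow> \<omega> \<in> space F \<Longrightarrow> ((\<lambda>s. X s \<omega>) \<longlongrightarrow> X s \<omega>) (at_right s)"
  using assms by (auto simp: rc_process_def)

lemma rc_process_bounded:
  assumes "rc_process F X" "\<omega> \<in> space F"
  obtains B where "0 \<le> B" "\<And>s. 0 \<le> s \<Longrightarrow> s \<le> T \<Longrightarrow> \<bar>X s \<omega>\<bar> \<le> B"
proof -
  obtain B where "\<forall>s\<in>{0..T}. \<bar>X s \<omega>\<bar> \<le> B" using assms unfolding rc_process_def by metis
  then show thesis by (intro that[of "max 0 B"]) (auto simp: le_max_iff_disj)
qed

text \<open>The sequence may hit \<open>s\<close>, which \<open>at_right\<close> excludes; hence the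
  passage to the filter within \<open>{s..}\<close>.\<close>

lemma rc_process_seq:
  assumes X: "rc_process F X" and \<omega>: "\<omega> \<in> space F" and s: "0 \<le> s"
    and x: "\<And>m. s \<le> x m" "x \<longlonglongrightarrow> s"
  shows "(\<lambda>m. X (x m) \<omega>) \<longlonglongrightarrow> X s \<omega>"
proof -
  have "{s..} - {s} = {s<..} - {s}" by auto
  then have "at s within {s..} = at_right s" by (simp only: at_within_def)
  then have "continuous (at s within {s..}) (\<lambda>s. X s \<omega>)"
    using rc_processD(2)[OF X s \<omega>] by (simp add: continuous_within)
  then show ?thesis
    by (rule continuous_within_tendsto_compose') (use x in auto)
qed

lemma rc_processI:
  assumes "\<And>s. 0 \<le> s \<Longrightarrow> X s \<in> borel_measurable F"
    and "\<And>\<omega> s. \<omega> \<in> space F \<Longrightarrow> 0 \<le> s \<Longrightarrow> ((\<lambda>s. X s \<omega>) \<longlongrightarrow> X s \<omega>) (at_right s)"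
    and "\<And>\<omega> T. \<omega> \<in> space F \<Longrightarrow> \<exists>B. \<forall>s\<in>{0..T}. \<bar>X s \<omega>\<bar> \<le> B"
  shows "rc_process F X"
  using assms by (auto simp: rc_process_def)

lemma rc_process_mult:
  assumes X: "rc_process F X" and Y: "rc_process F Y"
  shows "rc_process F (\<lambda>s \<omega>. X s \<omega> * Y s \<omega>)"
proof (rule rc_processI)
  fix \<omega> T assume \<omega>: "\<omega> \<in> space F"
  obtain B where B: "0 \<le> B" "\<And>s. 0 \<le> s \<Longrightarrow> s \<le> T \<Longrightarrow> \<bar>X s \<omega>\<bar> \<le> B" using rc_process_bounded[OF X \<omega>] by blast
  obtain C where C: "0 \<le> C" "\<And>s. 0 \<le> s \<Longrightarrow> s \<le> T \<Longrightarrow> \<bar>Y s \<omega>\<bar> \<le> C" using rc_process_bounded[OF Y \<omega>] by blast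
  show "\<exists>B. \<forall>s\<in>{0..T}. \<bar>X s \<omega> * Y s \<omega>\<bar> \<le> B"
    by (rule exI[of _ "B * C"]) (auto simp: abs_mult intro!: mult_mono B C)
qed (auto intro!: tendsto_intros borel_measurable_times rc_processD[OF X] rc_processD[OF Y])

lemma rc_process_compose:
  assumes X: "rc_process F X" and g: "continuous_on UNIV g"
  shows "rc_process F (\<lambda>s \<omega>. g (X s \<omega>))"
proof (rule rc_processI)
  fix s :: real assume "0 \<le> s"
  then show "(\<lambda>\<omega>. g (X s \<omega>)) \<in> borel_measurable F"
    using measurable_compose[OF rc_processD(1)[OF X] borel_measurable_continuous_onI[OF g]] by auto
next
  fix \<omega> and s :: real assume "\<omega> \<in> space F" "0 \<le> s"
  then show "((\<lambda>s. g (X s \<omega>)) \<longlongrightarrow> g (X s \<omega>)) (at_right s)"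
    using g by (intro isCont_tendsto_compose[of _ g] rc_processD(2)[OF X]) (auto simp: continuous_on_eq_continuous_at)
next
  fix \<omega> T assume \<omega>: "\<omega> \<in> space F"
  obtain B where B: "0 \<le> B" "\<And>s. 0 \<le> s \<Longrightarrow> s \<le> T \<Longrightarrow> \<bar>X s \<omega>\<bar> \<le> B" using rc_process_bounded[OF X \<omega>] by blast
  have "compact (g ` {-B..B})" using g by (intro compact_continuous_image) (auto intro: continuous_on_subset)
  then obtain C where C: "\<forall>x\<in>{-B..B}. \<bar>g x\<bar> \<le> C"
    by (auto dest!: compact_imp_bounded simp: bounded_iff)
  show "\<exists>B. \<forall>s\<in>{0..T}. \<bar>g (X s \<omega>)\<bar> \<le> B"
    using B(2) by (intro exI[of _ C] ballI C[rule_format]) (fastforce simp: abs_le_iff)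
qed

text \<open>Rounding the time up gives jointly measurable approximations, and right-continuity gives
  the limit. \<open>max 0\<close> extends the process to all real times, since nothing is assumed at
  negative ones.\<close>

lemma rc_process_joint_measurable:
  assumes X: "rc_process F X"
  shows "(\<lambda>(s, \<omega>). X (max 0 s) \<omega>) \<in> borel_measurable (borel \<Otimes>\<^sub>M F)"
proof (rule borel_measurable_LIMSEQ_real)
  let ?u = "\<lambda>r (s, \<omega>). X (round_up r (max 0 s)) \<omega>"
  fix x :: "real \<times> 'a" assume "x \<in> space (borel \<Otimes>\<^sub>M F)"
  then show "(\<lambda>r. ?u r x) \<longlonglongrightarrow> (case x of (s, \<omega>) \<Rightarrow> X (max 0 s) \<omega>)"
    by (auto simp: space_pair_measure split: prod.splits
        intro!: filterlim_compose[OF rc_processD(2)[OF X] round_up_at_right])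
next
  fix r
  have "(\<lambda>p. (\<lambda>s p. X s (snd p)) (round_up r (max 0 (fst p))) p) \<in> borel_measurable (borel \<Otimes>\<^sub>M F)"
    by (rule measurable_eval_round_up) (auto intro!: measurable_compose[OF measurable_snd] rc_processD[OF X])
  then show "(\<lambda>(s, \<omega>). X (round_up r (max 0 s)) \<omega>) \<in> borel_measurable (borel \<Otimes>\<^sub>M F)"
    by (simp add: split_beta')
qed

lemma rc_process_set_integrable:
  assumes X: "rc_process F X" and \<omega>: "\<omega> \<in> space F" and a: "0 \<le> a"
  shows "set_integrable lborel {a..b} (\<lambda>s. X s \<omega>)"
proof -
  obtain B where B: "0 \<le> B" "\<And>s. 0 \<le> s \<Longrightarrow> s \<le> b \<Longrightarrow> \<bar>X s \<omega>\<bar> \<le> B" using rc_process_bounded[OF X \<omega>] by blast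
  have "(\<lambda>s. X (max 0 s) \<omega>) \<in> borel_measurable borel"
    using measurable_compose[OF measurable_Pair2'[OF \<omega>] rc_process_joint_measurable[OF X]] by simp
  then have meas: "set_borel_measurable lborel {a..b} (\<lambda>s. X (max 0 s) \<omega>)"
    unfolding set_borel_measurable_def by measurable
  have const: "set_integrable lborel {a..b} (\<lambda>s. B)"
    unfolding set_integrable_def
    by (rule borel_integrable_compact) auto
  have "set_integrable lborel {a..b} (\<lambda>s. X (max 0 s) \<omega>)"
  proof (rule set_integrable_bound[OF const meas], rule AE_I2, rule impI)
    fix s assume "s \<in> {a..b}"
    then have "\<bar>X (max 0 s) \<omega>\<bar> \<le> B" using a by (intro B(2)) auto
    then show "norm (X (max 0 s) \<omega>) \<le> norm B" using B(1) by simp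
  qed
  also have "?this \<longleftrightarrow> ?thesis"
    using a by (intro set_integrable_cong) auto
  finally show ?thesis .
qed

lemma rc_process_integrable_on:
  assumes X: "rc_process F X" and \<omega>: "\<omega> \<in> space F" and a: "0 \<le> a"
  shows "(\<lambda>s. X s \<omega>) integrable_on {a..b}"
  using set_borel_integral_eq_integral(1)[OF rc_process_set_integrable[OF assms]] .

text \<open>The gauge integral agrees with a Lebesgue integral here, and the latter depends
  measurably on a parameter by joint measurability of the integrand.\<close>

lemma rc_process_integral_measurable:
  assumes X: "rc_process F X" and a: "0 \<le> a"
  shows "(\<lambda>\<omega>. integral {a..b} (\<lambda>s. X s \<omega>)) \<in> borel_measurable F"
proof -
  have [measurable]: "(\<lambda>p. X (max 0 (snd p)) (fst p)) \<in> borel_measurable (F \<Otimes>\<^sub>M lborel)"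
    using measurable_compose[OF measurable_pair_swap' rc_process_joint_measurable[OF X]]
    by (simp add: split_beta' cong: measurable_cong_sets)
  have "(\<lambda>\<omega>. \<integral>s. indicator {a..b} s *\<^sub>R X (max 0 s) \<omega> \<partial>lborel) \<in> borel_measurable F"
    by (rule lborel.borel_measurable_lebesgue_integral) measurable
  also have "?this \<longleftrightarrow> ?thesis"
  proof (rule measurable_cong)
    fix \<omega> assume \<omega>: "\<omega> \<in> space F"
    have "(\<integral>s. indicator {a..b} s *\<^sub>R X (max 0 s) \<omega> \<partial>lborel) = (\<integral>s. indicator {a..b} s *\<^sub>R X s \<omega> \<partial>lborel)"
      using a by (intro Bochner_Integration.integral_cong) (auto simp: indicator_def)
    also have "\<dots> = integral {a..b} (\<lambda>s. X s \<omega>)"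
      using set_borel_integral_eq_integral(2)[OF rc_process_set_integrable[OF X \<omega> a]]
      by (simp add: set_lebesgue_integral_def)
    finally show "(\<integral>s. indicator {a..b} s *\<^sub>R X (max 0 s) \<omega> \<partial>lborel) = integral {a..b} (\<lambda>s. X s \<omega>)" .
  qed
  finally show ?thesis .
qed

lemma rc_process_integral:
  assumes X: "rc_process F X"
  shows "rc_process F (\<lambda>s \<omega>. integral {s..t} (\<lambda>r. X r \<omega>))"
proof (rule rc_processI)
  fix \<omega> and s :: real assume \<omega>: "\<omega> \<in> space F" and s: "0 \<le> s"
  let ?I = "\<lambda>s. integral {s..t} (\<lambda>r. X r \<omega>)"
  show "(?I \<longlongrightarrow> ?I s) (at_right s)"
  proof (cases "s < t")
    case True
    have "continuous_on {s..t} ?I"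
      by (rule indefinite_integral_continuous_1'[OF rc_process_integrable_on[OF X \<omega> s]])
    then have "(?I \<longlongrightarrow> ?I s) (at s within {s..t})" using True by (auto simp: continuous_on)
    then show ?thesis using True by (simp add: at_within_Icc_at_right)
  next
    case False
    \<comment> \<open>From \<open>t\<close> on, the interval is a point or empty and the integral
      stays 0.\<close>
    have "\<forall>\<^sub>F x in at_right s. ?I s = ?I x"
      using eventually_at_right_less[of s]
    proof eventually_elim
      case (elim x)
      then show ?case using False by (cases "s = t") auto
    qed
    then show ?thesis by (rule Lim_transform_eventually[OF tendsto_const])
  qed
next
  fix \<omega> and T :: real assume \<omega>: "\<omega> \<in> space F"
  obtain B where B: "0 \<le> B" "\<And>s. 0 \<le> s \<Longrightarrow> s \<le> t \<Longrightarrow> \<bar>X s \<omega>\<bar> \<le> B" using rc_process_bounded[OF X \<omega>] by blast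
  show "\<exists>B. \<forall>s\<in>{0..T}. \<bar>integral {s..t} (\<lambda>r. X r \<omega>)\<bar> \<le> B"
  proof (intro exI ballI)
    fix s assume s: "s \<in> {0..T}"
    have "norm (integral {s..t} (\<lambda>r. X r \<omega>)) \<le> B * Henstock_Kurzweil_Integration.content (cbox s t)"
      using s B rc_process_integrable_on[OF X \<omega>, of s t]
      by (intro has_integral_bound[where f="\<lambda>r. X r \<omega>"]) (auto simp: integrable_integral)
    also have "\<dots> \<le> B * \<bar>t\<bar>" using s B by (intro mult_left_mono) (auto simp: content_real_if split: if_splits)
    finally show "\<bar>integral {s..t} (\<lambda>r. X r \<omega>)\<bar> \<le> B * \<bar>t\<bar>" by simp
  qed
qed (intro rc_process_integral_measurable X)

section \<open>Integrating out an independent Poisson clock\<close>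

text \<open>Independence makes the joint law a product, and Fubini then plays the part of
  conditioning on \<open>X\<close>. Independence is assumed between families containing the
  preimages, so that one sigma-algebra serves many choices of \<open>X\<close>.\<close>

lemma (in prob_space) integral_indep_freeze:
  fixes f :: "'b \<times> 'c \<Rightarrow> real"
  assumes X[measurable]: "X \<in> measurable M S" and Y[measurable]: "Y \<in> measurable M T"
    and ind: "indep_set \<A> \<B>"
    and XA: "\<And>A. A \<in> sets S \<Longrightarrow> X -` A \<inter> space M \<in> \<A>"
    and YB: "\<And>B. B \<in> sets T \<Longrightarrow> Y -` B \<inter> space M \<in> \<B>"
    and f[measurable]: "f \<in> borel_measurable (S \<Otimes>\<^sub>M T)" and bd: "\<And>p. \<bar>f p\<bar> \<le> 1"
  shows "(\<integral>\<omega>. f (X \<omega>, Y \<omega>) \<partial>M) = (\<integral>\<omega>. (\<integral>\<omega>'. f (X \<omega>, Y \<omega>') \<partial>M) \<partial>M)"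
proof -
  interpret X: prob_space "distr M S X" by (rule prob_space_distr) fact
  interpret Y: prob_space "distr M T Y" by (rule prob_space_distr) fact
  interpret P: pair_prob_space "distr M S X" "distr M T Y" ..
  have eq: "distr M S X \<Otimes>\<^sub>M distr M T Y = distr M (S \<Otimes>\<^sub>M T) (\<lambda>\<omega>. (X \<omega>, Y \<omega>))"
  proof (rule pair_measure_eqI)
    fix A B assume "A \<in> sets (distr M S X)" "B \<in> sets (distr M T Y)"
    then have A[measurable]: "A \<in> sets S" and B[measurable]: "B \<in> sets T" by auto
    have "prob ((X -` A \<inter> space M) \<inter> (Y -` B \<inter> space M)) = prob (X -` A \<inter> space M) * prob (Y -` B \<inter> space M)"
      by (rule indep_setD[OF ind XA[OF A] YB[OF B]])
    moreover have "(\<lambda>\<omega>. (X \<omega>, Y \<omega>)) -` (A \<times> B) \<inter> space M = (X -` A \<inter> space M) \<inter> (Y -` B \<inter> space M)" by auto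
    ultimately show "emeasure (distr M S X) A * emeasure (distr M T Y) B =
        emeasure (distr M (S \<Otimes>\<^sub>M T) (\<lambda>\<omega>. (X \<omega>, Y \<omega>))) (A \<times> B)"
      by (simp add: emeasure_distr emeasure_eq_measure ennreal_mult)
  qed (auto intro!: X.sigma_finite_measure_axioms Y.sigma_finite_measure_axioms sets_pair_measure_cong)
  have int: "integrable (distr M S X \<Otimes>\<^sub>M distr M T Y) f"
    by (rule P.integrable_const_bound[where B=1]) (auto simp: bd)
  have "(\<integral>\<omega>. f (X \<omega>, Y \<omega>) \<partial>M) = integral\<^sup>L (distr M S X \<Otimes>\<^sub>M distr M T Y) f"
    unfolding eq by (subst integral_distr) auto
  also have "\<dots> = (\<integral>x. (\<integral>y. f (x, y) \<partial>distr M T Y) \<partial>distr M S X)"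
    by (rule P.integral_fst'[OF int, symmetric])
  also have "\<dots> = (\<integral>\<omega>. (\<integral>y. f (X \<omega>, y) \<partial>distr M T Y) \<partial>M)"
    by (subst integral_distr) auto
  also have "\<dots> = (\<integral>\<omega>. (\<integral>\<omega>'. f (X \<omega>, Y \<omega>') \<partial>M) \<partial>M)"
    by (intro Bochner_Integration.integral_cong refl, subst integral_distr)
      (auto intro!: measurable_compose[OF _ f] dest: measurable_space[OF X])
  finally show ?thesis .
qed

lemma integral_poisson_pmf_power:
  assumes "0 < d" "0 \<le> c" "c \<le> 1"
  shows "(\<integral>k. c ^ k \<partial>measure_pmf (poisson_pmf d)) = exp (- (1 - c) * d)"
proof -
  have s: "(\<lambda>k. pois d k * c ^ k) sums exp (- (1 - c) * d)" by (rule pois_pgf_sums)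
  have "(\<integral>k. c ^ k \<partial>measure_pmf (poisson_pmf d)) = (\<integral>k. pois d k * c ^ k \<partial>count_space UNIV)"
    unfolding measure_pmf_eq_density
    by (subst integral_density) (use assms in \<open>auto simp: pois_def\<close>)
  also have "\<dots> = (\<Sum>k. pois d k * c ^ k)"
    by (rule integral_count_space_nat)
       (use assms s in \<open>auto simp: integrable_count_space_nat_iff pois_nonneg abs_mult intro: sums_summable\<close>)
  finally show ?thesis using s by (simp add: sums_iff)
qed

lemma (in prob_space) poisson_increments_pgf:
  assumes N: "std_poisson_process M N"
    and a: "0 \<le> a 0" "\<And>i. i < m \<Longrightarrow> a i \<le> a (Suc i)" and c: "\<And>i. 0 \<le> c i \<and> c i \<le> (1::real)"
  shows "(\<integral>\<omega>. (\<Prod>i<m. c i ^ (N \<omega> (a (Suc i)) - N \<omega> (a i))) \<partial>M) = (\<Prod>i<m. exp (- (1 - c i) * (a (Suc i) - a i)))"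
proof -
  have "N \<in> measurable M (Pi\<^sub>M UNIV (\<lambda>_. count_space UNIV))" using N by (simp add: std_poisson_process_def)
  then have [measurable]: "(\<lambda>\<omega>. N \<omega> s) \<in> measurable M (count_space UNIV)" for s
    using measurable_compose[OF _ measurable_component_singleton[of s UNIV "\<lambda>_. count_space UNIV"]] by simp
  have a0: "0 \<le> a i" if "i \<le> m" for i
    using that
  proof (induction i)
    case (Suc i)
    then show ?case using a(2)[of i] by simp
  qed (simp add: a)
  have "indep_vars (\<lambda>_. count_space UNIV) (\<lambda>i \<omega>. N \<omega> (a (Suc i)) - N \<omega> (a i)) {..<m}"
    using N a unfolding std_poisson_process_def by blast
  then have ind: "indep_vars (\<lambda>_. borel) (\<lambda>i \<omega>. c i ^ (N \<omega> (a (Suc i)) - N \<omega> (a i))) {..<m}"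
    by (rule indep_vars_compose2) auto
  have "(\<integral>\<omega>. (\<Prod>i<m. c i ^ (N \<omega> (a (Suc i)) - N \<omega> (a i))) \<partial>M) = (\<Prod>i<m. \<integral>\<omega>. c i ^ (N \<omega> (a (Suc i)) - N \<omega> (a i)) \<partial>M)"
    by (rule indep_vars_lebesgue_integral[OF _ ind])
       (auto intro!: integrable_const_bound[where B=1] simp: c power_le_one power_abs)
  also have "\<dots> = (\<Prod>i<m. exp (- (1 - c i) * (a (Suc i) - a i)))"
  proof (rule prod.cong[OF refl])
    fix i assume "i \<in> {..<m}"
    then have i: "i < m" by simp
    show "(\<integral>\<omega>. c i ^ (N \<omega> (a (Suc i)) - N \<omega> (a i)) \<partial>M) = exp (- (1 - c i) * (a (Suc i) - a i))"
    \<comment> \<open>The Poisson law of increments is given only for distinct times; at equal times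
      the increment is 0.\<close>
    proof (cases "a i = a (Suc i)")
      case True
      then show ?thesis by (simp add: prob_space)
    next
      case False
      then have lt: "a i < a (Suc i)" using a(2)[OF i] by simp
      then have D: "distr M (count_space UNIV) (\<lambda>\<omega>. N \<omega> (a (Suc i)) - N \<omega> (a i)) = measure_pmf (poisson_pmf (a (Suc i) - a i))"
        using N a0[of i] i unfolding std_poisson_process_def by auto
      have "(\<integral>k. c i ^ k \<partial>distr M (count_space UNIV) (\<lambda>\<omega>. N \<omega> (a (Suc i)) - N \<omega> (a i))) =
          (\<integral>\<omega>. c i ^ (N \<omega> (a (Suc i)) - N \<omega> (a i)) \<partial>M)"
        by (rule integral_distr) auto
      then show ?thesis
        using integral_poisson_pmf_power[of "a (Suc i) - a i" "c i"] lt c by (simp add: D)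
    qed
  qed
  finally show ?thesis .
qed

text \<open>\<open>F\<close> carries the background information, \<open>L\<close> is the arrival
  intensity, and the unit-rate clock \<open>N\<close> is independent of \<open>F\<close>. The queue
  enters only through \<open>L\<close>.\<close>

locale cox_clock = prob_space M for M :: "'a measure" +
  fixes F :: "'a measure" and L :: "real \<Rightarrow> 'a \<Rightarrow> real" and N :: "'a \<Rightarrow> real \<Rightarrow> nat" and t :: real
  assumes space_F: "space F = space M" and sets_F: "sets F \<subseteq> sets M"
    and L: "rc_process F L" and L_nonneg: "\<And>s \<omega>. 0 \<le> s \<Longrightarrow> \<omega> \<in> space M \<Longrightarrow> 0 \<le> L s \<omega>"
    and N: "std_poisson_process M N"
    and indep: "indep_set (sets F)
      (sigma_sets (space M) {N -` A \<inter> space M | A. A \<in> sets (Pi\<^sub>M UNIV (\<lambda>_. count_space UNIV))})"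
    and t: "0 \<le> t"
begin

lemma measurable_F_M: "f \<in> measurable F S \<Longrightarrow> f \<in> measurable M S"
  using sets_F space_F by (auto simp: measurable_def)

lemma N_eventually_const:
  assumes "\<omega> \<in> space M" "0 \<le> u" shows "\<forall>\<^sub>F v in at_right u. N \<omega> v = N \<omega> u"
  using N assms by (auto simp: std_poisson_process_def tendsto_discrete)

lemma N_mono: "\<omega> \<in> space M \<Longrightarrow> 0 \<le> u \<Longrightarrow> u \<le> v \<Longrightarrow> N \<omega> u \<le> N \<omega> v"
  using N unfolding std_poisson_process_def by (auto dest!: bspec[of _ _ \<omega>] elim!: mono_onD)

lemma N_0: "\<omega> \<in> space M \<Longrightarrow> N \<omega> 0 = 0"
  using N by (auto simp: std_poisson_process_def)

lemma N_meas: "N \<in> measurable M (Pi\<^sub>M UNIV (\<lambda>_. count_space UNIV))"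
  using N by (simp add: std_poisson_process_def)

lemma N_round_up_tendsto:
  assumes "\<omega> \<in> space M" "0 \<le> u" shows "(\<lambda>r. N \<omega> (round_up r u)) \<longlonglongrightarrow> N \<omega> u"
  unfolding tendsto_discrete
  using N_eventually_const[OF assms] round_up_at_right[of u] by (auto simp: filterlim_iff)

text \<open>The clock is read at random times, and \<open>N \<omega> (a i \<omega>)\<close> is not a
  measurable function of the pair (time, path) on the product space. The times are rounded up so
  that freezing applies, and the rounding is then removed: on the left \<open>N\<close> is locally
  constant to the right, on the right the exponentials are continuous.\<close>

lemma integral_increments_pgf:
  assumes a: "\<And>i. a i \<in> borel_measurable F" and c: "\<And>i. c i \<in> borel_measurable F"
    and a0: "\<And>\<omega>. \<omega> \<in> space M \<Longrightarrow> 0 \<le> a 0 \<omega>"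
    and a_mono: "\<And>i \<omega>. \<omega> \<in> space M \<Longrightarrow> a i \<omega> \<le> a (Suc i) \<omega>"
    and c01: "\<And>i \<omega>. \<omega> \<in> space M \<Longrightarrow> 0 \<le> c i \<omega> \<and> c i \<omega> \<le> (1::real)"
  shows "(\<integral>\<omega>. (\<Prod>i<m. c i \<omega> ^ (N \<omega> (a (Suc i) \<omega>) - N \<omega> (a i \<omega>))) \<partial>M) =
         (\<integral>\<omega>. (\<Prod>i<m. exp (- (1 - c i \<omega>) * (a (Suc i) \<omega> - a i \<omega>))) \<partial>M)" (is "?lhs = ?rhs")
proof -
  note [measurable] = measurable_F_M[OF a] measurable_F_M[OF c]
  let ?PN = "Pi\<^sub>M UNIV (\<lambda>_::real. count_space (UNIV :: nat set))"
  let ?PR = "Pi\<^sub>M UNIV (\<lambda>_::nat. borel :: real measure)"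
  have an: "0 \<le> a i \<omega>" if "\<omega> \<in> space M" for i \<omega>
    by (induction i) (use a0 a_mono that order_trans in blast)+
  \<comment> \<open>Clipping changes no actual value of \<open>c\<close>, but bounds
    \<open>f\<close> by 1 on the whole product space, as freezing requires. The \<open>max 0\<close>
    in \<open>f\<close> likewise keeps all times nonnegative.\<close>
  define cl :: "real \<Rightarrow> real" where "cl x = max 0 (min 1 x)" for x
  have cl01: "0 \<le> cl x" "cl x \<le> 1" for x by (auto simp: cl_def)
  have clc: "cl (c i \<omega>) = c i \<omega>" if "\<omega> \<in> space M" for i \<omega> using c01[OF that] by (simp add: cl_def)
  have [measurable]: "cl \<in> borel_measurable borel" unfolding cl_def by measurable
  define f where "f r p = (\<Prod>i<m. cl (snd (fst p) i) ^
      (snd p (round_up r (max 0 (fst (fst p) (Suc i)))) - snd p (round_up r (max 0 (fst (fst p) i)))))"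
    for r and p :: "((nat \<Rightarrow> real) \<times> (nat \<Rightarrow> real)) \<times> (real \<Rightarrow> nat)"
  have ev[measurable]: "(\<lambda>p. snd p (round_up r (max 0 (fst (fst p) i)))) \<in> measurable ((?PR \<Otimes>\<^sub>M ?PR) \<Otimes>\<^sub>M ?PN) (count_space UNIV)" for r i
    by (rule measurable_eval_round_up[where X="\<lambda>s p. snd p s"]) auto
  have f_meas: "f r \<in> borel_measurable ((?PR \<Otimes>\<^sub>M ?PR) \<Otimes>\<^sub>M ?PN)" for r
    unfolding f_def by measurable
  have f01: "\<bar>f r p\<bar> \<le> 1" for r p
    unfolding f_def by (auto simp: abs_prod power_abs cl01 intro!: prod_le_1 power_le_one)
  let ?W = "\<lambda>\<omega>. (\<lambda>i. a i \<omega>, \<lambda>i. c i \<omega>)"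
  have W: "?W \<in> measurable F (?PR \<Otimes>\<^sub>M ?PR)"
    by (intro measurable_Pair measurable_PiM_single') (auto simp: a c)
  have WM: "?W \<in> measurable M (?PR \<Otimes>\<^sub>M ?PR)" by (rule measurable_F_M[OF W])
  define R where "R r \<omega> = (\<Prod>i<m. exp (- (1 - c i \<omega>) * (round_up r (a (Suc i) \<omega>) - round_up r (a i \<omega>))))" for r \<omega>
  have step: "(\<integral>\<omega>. f r (?W \<omega>, N \<omega>) \<partial>M) = (\<integral>\<omega>. R r \<omega> \<partial>M)" for r
  proof -
    have "(\<integral>\<omega>. f r (?W \<omega>, N \<omega>) \<partial>M) = (\<integral>\<omega>. (\<integral>\<omega>'. f r (?W \<omega>, N \<omega>') \<partial>M) \<partial>M)"
    proof (rule integral_indep_freeze[OF WM N_meas indep _ _ f_meas f01])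
      show "?W -` A \<inter> space M \<in> sets F" if "A \<in> sets (?PR \<Otimes>\<^sub>M ?PR)" for A
        using measurable_sets[OF W that] by (simp add: space_F)
    qed auto
    also have "\<dots> = (\<integral>\<omega>. R r \<omega> \<partial>M)"
    proof (rule Bochner_Integration.integral_cong[OF refl])
      fix \<omega> assume \<omega>: "\<omega> \<in> space M"
      have "(\<integral>\<omega>'. f r (?W \<omega>, N \<omega>') \<partial>M) =
          (\<integral>\<omega>'. (\<Prod>i<m. c i \<omega> ^ (N \<omega>' (round_up r (a (Suc i) \<omega>)) - N \<omega>' (round_up r (a i \<omega>)))) \<partial>M)"
        by (simp add: f_def clc[OF \<omega>] an[OF \<omega>] max_absorb2)
      also have "\<dots> = R r \<omega>"
        unfolding R_def
      proof (rule poisson_increments_pgf[OF N])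
        show "0 \<le> round_up r (a 0 \<omega>)" using an[OF \<omega>, of 0] round_up_gt[of "a 0 \<omega>" r] by simp
      qed (intro round_up_mono a_mono[OF \<omega>] c01[OF \<omega>])+
      finally show "(\<integral>\<omega>'. f r (?W \<omega>, N \<omega>') \<partial>M) = R r \<omega>" .
    qed
    finally show ?thesis .
  qed
  have fW[measurable]: "(\<lambda>\<omega>. f r (?W \<omega>, N \<omega>)) \<in> borel_measurable M" for r
    by (rule measurable_compose[OF measurable_Pair[OF WM N_meas] f_meas])
  have R_meas[measurable]: "R r \<in> borel_measurable M" for r
    unfolding R_def round_up_def by measurable
  have limL: "(\<lambda>r. f r (?W \<omega>, N \<omega>)) \<longlonglongrightarrow> (\<Prod>i<m. c i \<omega> ^ (N \<omega> (a (Suc i) \<omega>) - N \<omega> (a i \<omega>)))"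
    if \<omega>: "\<omega> \<in> space M" for \<omega>
  proof -
    have "\<forall>\<^sub>F r in sequentially. \<forall>i\<in>{..m}. N \<omega> (round_up r (a i \<omega>)) = N \<omega> (a i \<omega>)"
      using N_round_up_tendsto[OF \<omega> an[OF \<omega>]] by (intro eventually_ball_finite) (auto simp: tendsto_discrete)
    then have "\<forall>\<^sub>F r in sequentially. (\<Prod>i<m. c i \<omega> ^ (N \<omega> (a (Suc i) \<omega>) - N \<omega> (a i \<omega>))) = f r (?W \<omega>, N \<omega>)"
      by eventually_elim (auto simp: f_def clc[OF \<omega>] an[OF \<omega>] max_absorb2 intro!: prod.cong)
    then show ?thesis by (rule Lim_transform_eventually[OF tendsto_const])
  qed
  have [measurable]: "(\<lambda>\<omega>. \<Prod>i<m. c i \<omega> ^ (N \<omega> (a (Suc i) \<omega>) - N \<omega> (a i \<omega>))) \<in> borel_measurable M"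
    by (rule borel_measurable_LIMSEQ_real[OF limL fW])
  have "(\<lambda>r. \<integral>\<omega>. f r (?W \<omega>, N \<omega>) \<partial>M) \<longlonglongrightarrow> ?lhs"
    by (rule integral_dominated_convergence[where w="\<lambda>_. 1"]) (auto simp: f01 limL)
  moreover have "(\<lambda>r. \<integral>\<omega>. R r \<omega> \<partial>M) \<longlonglongrightarrow> ?rhs"
  proof (rule integral_dominated_convergence[where w="\<lambda>_. 1"])
    have ru: "(\<lambda>r. round_up r x) \<longlonglongrightarrow> x" for x
      using round_up_at_right[of x] by (simp add: filterlim_at)
    show "AE \<omega> in M. (\<lambda>r. R r \<omega>) \<longlonglongrightarrow> (\<Prod>i<m. exp (- (1 - c i \<omega>) * (a (Suc i) \<omega> - a i \<omega>)))"
      unfolding R_def by (intro AE_I2 tendsto_intros ru)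
    show "AE \<omega> in M. norm (R r \<omega>) \<le> 1" for r
    proof (rule AE_I2)
      fix \<omega> assume \<omega>: "\<omega> \<in> space M"
      have "(c i \<omega> - 1) * (round_up r (a (Suc i) \<omega>) - round_up r (a i \<omega>)) \<le> 0" for i
        using c01[OF \<omega>] a_mono[OF \<omega>] by (intro mult_nonpos_nonneg) (auto intro: round_up_mono)
      then show "norm (R r \<omega>) \<le> 1"
        unfolding R_def by (auto simp: abs_prod intro!: prod_le_1)
    qed
  qed auto
  ultimately show ?thesis
    unfolding step by (rule LIMSEQ_unique)
qed

section \<open>The time-changed counting process and its arrival times\<close>

definition A :: "real \<Rightarrow> 'a \<Rightarrow> real" where "A s \<omega> = integral {0..s} (\<lambda>r. L r \<omega>)"
definition Y :: "real \<Rightarrow> 'a \<Rightarrow> nat" where "Y s \<omega> = N \<omega> (A s \<omega>)"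
definition arrival :: "nat \<Rightarrow> 'a \<Rightarrow> real" where "arrival k \<omega> = Inf {s. 0 \<le> s \<and> k \<le> Y s \<omega>}"

lemma L_integrable: "\<omega> \<in> space M \<Longrightarrow> 0 \<le> a \<Longrightarrow> (\<lambda>r. L r \<omega>) integrable_on {a..b}"
  using rc_process_integrable_on[OF L] by (simp add: space_F)

lemma A_mono: assumes "\<omega> \<in> space M" "0 \<le> s" "s \<le> s'" shows "A s \<omega> \<le> A s' \<omega>"
  unfolding A_def using assms by (intro integral_subset_le L_integrable) (auto intro: L_nonneg)

lemma A_0 [simp]: "A 0 \<omega> = 0" by (simp add: A_def)

lemma A_nonneg: "\<omega> \<in> space M \<Longrightarrow> 0 \<le> s \<Longrightarrow> 0 \<le> A s \<omega>"
  using A_mono[of \<omega> 0 s] by simp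

lemma A_diff: assumes "\<omega> \<in> space M" "0 \<le> s" "s \<le> s'"
  shows "A s' \<omega> - A s \<omega> = integral {s..s'} (\<lambda>r. L r \<omega>)"
  unfolding A_def using Henstock_Kurzweil_Integration.integral_combine[OF assms(2,3) L_integrable[OF assms(1), of 0]] by simp

lemma A_tendsto: assumes "\<omega> \<in> space M" "0 \<le> s" shows "((\<lambda>s. A s \<omega>) \<longlongrightarrow> A s \<omega>) (at_right s)"
proof -
  have "continuous_on {0..s+1} (\<lambda>s. A s \<omega>)"
    unfolding A_def by (rule indefinite_integral_continuous_1[OF L_integrable[OF assms(1)]]) simp
  then have "continuous_on {s..s+1} (\<lambda>s. A s \<omega>)"
    by (rule continuous_on_subset) (use assms in auto)
  then have "((\<lambda>s. A s \<omega>) \<longlongrightarrow> A s \<omega>) (at s within {s..s+1})"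
    by (auto simp: continuous_on)
  then show ?thesis by (simp add: at_within_Icc_at_right)
qed

lemma A_meas: "0 \<le> s \<Longrightarrow> A s \<in> borel_measurable F"
  using rc_process_integral_measurable[OF L, of 0 s] by (simp add: A_def[abs_def])

lemma Y_mono: assumes "\<omega> \<in> space M" "0 \<le> s" "s \<le> s'" shows "Y s \<omega> \<le> Y s' \<omega>"
  unfolding Y_def using assms by (intro N_mono A_mono A_nonneg)

lemma Y_0 [simp]: "\<omega> \<in> space M \<Longrightarrow> Y 0 \<omega> = 0" by (simp add: Y_def N_0)

text \<open>\<open>A\<close> is continuous and nondecreasing, so just after \<open>s\<close> it
  remains in the stretch to the right of \<open>A s\<close> on which \<open>N\<close> is
  constant.\<close>

lemma Y_eventually_const: assumes "\<omega> \<in> space M" "0 \<le> s"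
  shows "\<forall>\<^sub>F s' in at_right s. Y s' \<omega> = Y s \<omega>"
proof -
  obtain b where b: "A s \<omega> < b" "\<And>v. A s \<omega> < v \<Longrightarrow> v < b \<Longrightarrow> N \<omega> v = N \<omega> (A s \<omega>)"
    using N_eventually_const[OF assms(1) A_nonneg[OF assms]] unfolding eventually_at_right_field by blast
  have "\<forall>\<^sub>F s' in at_right s. A s' \<omega> < b" using A_tendsto[OF assms] b(1) by (rule order_tendstoD(2))
  then show ?thesis using eventually_at_right_less[of s]
  proof eventually_elim
    case (elim s')
    then have "A s \<omega> \<le> A s' \<omega>" using assms by (intro A_mono) auto
    then show ?case unfolding Y_def using b(2)[of "A s' \<omega>"] elim by (cases "A s' \<omega> = A s \<omega>") auto
  qed
qed

text \<open>Right-continuity makes the infimum attained. The hypothesis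
  \<open>k \<le> Y t \<omega>\<close> makes the set nonempty, without which \<open>Inf\<close> is
  uncontrolled.\<close>

lemma arrival_le_iff:
  assumes \<omega>: "\<omega> \<in> space M" and k: "k \<le> Y t \<omega>" and s: "0 \<le> s"
  shows "arrival k \<omega> \<le> s \<longleftrightarrow> k \<le> Y s \<omega>"
proof
  let ?S = "{s. 0 \<le> s \<and> k \<le> Y s \<omega>}"
  have ne: "t \<in> ?S" and bb: "bdd_below ?S" using k t by auto
  show "arrival k \<omega> \<le> s" if "k \<le> Y s \<omega>"
    unfolding arrival_def using that s by (intro cInf_lower bb) auto
  assume le: "arrival k \<omega> \<le> s"
  obtain b where b: "s < b" "\<And>v. s < v \<Longrightarrow> v < b \<Longrightarrow> Y v \<omega> = Y s \<omega>"
    using Y_eventually_const[OF \<omega> s] unfolding eventually_at_right_field by blast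
  have "Inf ?S < b" using le b(1) by (simp add: arrival_def)
  then obtain v where v: "v \<in> ?S" "v < b" using cInf_lessD[of ?S b] ne by blast
  show "k \<le> Y s \<omega>"
  proof (cases "v \<le> s")
    case True
    then show ?thesis using Y_mono[OF \<omega>, of v s] v by auto
  next
    case False
    then show ?thesis using b(2)[of v] v by auto
  qed
qed

lemma arrival_bounds:
  assumes \<omega>: "\<omega> \<in> space M" and k: "k \<le> Y t \<omega>"
  shows "0 \<le> arrival k \<omega>" "arrival k \<omega> \<le> t"
  using arrival_le_iff[OF assms t] k t
  unfolding arrival_def by (auto intro!: cInf_greatest)

section \<open>Discretisation of the arrival times\<close>

definition grid :: "nat \<Rightarrow> nat \<Rightarrow> real" where "grid m i = t * real i / real (Suc m)"
text \<open>Index of the right endpoint of the cell containing the \<open>k\<close>-th arrival.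
  Defining it from the values of \<open>Y\<close> on the grid makes it measurable before the arrival
  times are known to be.\<close>

definition slot :: "nat \<Rightarrow> nat \<Rightarrow> 'a \<Rightarrow> nat" where "slot m k \<omega> = (LEAST i. k \<le> Y (grid m i) \<omega>)"

lemma grid_nonneg: "0 \<le> grid m i" using t by (simp add: grid_def)
lemma grid_0 [simp]: "grid m 0 = 0" by (simp add: grid_def)
lemma grid_end [simp]: "grid m (Suc m) = t" by (simp add: grid_def)
lemma grid_mono: "i \<le> j \<Longrightarrow> grid m i \<le> grid m j"
  using t by (auto simp: grid_def intro!: divide_right_mono mult_left_mono)
lemma grid_Suc: "grid m (Suc i) = grid m i + t / real (Suc m)"
  by (simp add: grid_def add_divide_distrib distrib_left)

lemma slot_bounds:
  assumes \<omega>: "\<omega> \<in> space M" and k: "0 < k" "k \<le> Y t \<omega>"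
  shows "arrival k \<omega> \<le> grid m (slot m k \<omega>)" "grid m (slot m k \<omega>) \<le> arrival k \<omega> + t / real (Suc m)"
    "grid m (slot m k \<omega>) \<le> t"
proof -
  have ex: "k \<le> Y (grid m (Suc m)) \<omega>" using k by simp
  then have s: "k \<le> Y (grid m (slot m k \<omega>)) \<omega>" unfolding slot_def by (rule LeastI)
  then show "arrival k \<omega> \<le> grid m (slot m k \<omega>)" using arrival_le_iff[OF \<omega> k(2) grid_nonneg] by simp
  have "slot m k \<omega> \<le> Suc m" unfolding slot_def using ex by (rule Least_le)
  then show "grid m (slot m k \<omega>) \<le> t" using grid_mono[of "slot m k \<omega>" "Suc m" m] by simp
  \<comment> \<open>The slot has a predecessor because \<open>Y\<close> starts at 0, below
    \<open>k\<close>.\<close>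
  obtain j where j: "slot m k \<omega> = Suc j" using s k \<omega> by (cases "slot m k \<omega>") auto
  then have "\<not> k \<le> Y (grid m j) \<omega>" unfolding slot_def by (intro not_less_Least) simp
  then have "grid m j < arrival k \<omega>" using arrival_le_iff[OF \<omega> k(2) grid_nonneg[of m j]] by simp
  then show "grid m (slot m k \<omega>) \<le> arrival k \<omega> + t / real (Suc m)" by (simp add: j grid_Suc)
qed

lemma slot_tendsto:
  assumes \<omega>: "\<omega> \<in> space M" and k: "0 < k" "k \<le> Y t \<omega>" and X: "rc_process F X"
  shows "(\<lambda>m. X (grid m (slot m k \<omega>)) \<omega>) \<longlonglongrightarrow> X (arrival k \<omega>) \<omega>"
proof (rule rc_process_seq[OF X])
  show "(\<lambda>m. grid m (slot m k \<omega>)) \<longlonglongrightarrow> arrival k \<omega>"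
  proof (rule tendsto_sandwich[OF _ _ tendsto_const])
    have "(\<lambda>m. arrival k \<omega> + t * (1 / real (Suc m))) \<longlonglongrightarrow> arrival k \<omega> + t * 0"
      by (intro tendsto_intros LIMSEQ_Suc[OF lim_1_over_n])
    then show "(\<lambda>m. arrival k \<omega> + t / real (Suc m)) \<longlonglongrightarrow> arrival k \<omega>" by simp
  qed (intro always_eventually allI slot_bounds assms)+
qed (use assms in \<open>auto simp: space_F intro: slot_bounds arrival_bounds\<close>)

text \<open>\<open>H\<close> is left open since two choices occur: the full sigma-algebra, and the
  one generated by background and clock, of which the requirements are independent.\<close>

lemma Y_meas:
  assumes H: "space H = space M" "sets F \<subseteq> sets H" "N \<in> measurable H (Pi\<^sub>M UNIV (\<lambda>_. count_space UNIV))"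
    and s: "0 \<le> s"
  shows "Y s \<in> measurable H (count_space UNIV)"
proof -
  have [measurable]: "(\<lambda>\<omega>. N \<omega> s) \<in> measurable H (count_space UNIV)" for s
    using measurable_compose[OF H(3) measurable_component_singleton[of s UNIV "\<lambda>_. count_space UNIV"]] by simp
  have A: "A s \<in> borel_measurable H" using A_meas[OF s] H(1,2) space_F by (auto simp: measurable_def)
  have "(\<lambda>\<omega>. real (Y s \<omega>)) \<in> borel_measurable H"
  proof (rule borel_measurable_LIMSEQ_real)
    fix \<omega> assume "\<omega> \<in> space H"
    then show "(\<lambda>r. real (N \<omega> (round_up r (A s \<omega>)))) \<longlonglongrightarrow> real (Y s \<omega>)"
      using N_round_up_tendsto[OF _ A_nonneg[OF _ s], of \<omega> \<omega>] H(1)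
      by (intro tendsto_eventually) (auto simp: Y_def tendsto_discrete elim: eventually_mono)
  next
    fix r
    have "(\<lambda>\<omega>. N \<omega> (round_up r (A s \<omega>))) \<in> measurable H (count_space UNIV)"
      by (rule measurable_eval_round_up[where X="\<lambda>s \<omega>. N \<omega> s"]) (use A H(1) s A_nonneg in auto)
    then show "(\<lambda>\<omega>. real (N \<omega> (round_up r (A s \<omega>)))) \<in> borel_measurable H" by measurable
  qed
  then have "(\<lambda>\<omega>. nat \<lfloor>real (Y s \<omega>)\<rfloor>) \<in> measurable H (count_space UNIV)" by measurable
  then show ?thesis by simp
qed

text \<open>The limit of values at grid slots. The default 0 covers outcomes with fewer than
  \<open>k\<close> arrivals, where \<open>arrival k\<close> carries no information.\<close>

lemma at_arrival_meas:
  assumes H: "space H = space M" "sets F \<subseteq> sets H" "N \<in> measurable H (Pi\<^sub>M UNIV (\<lambda>_. count_space UNIV))"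
    and X: "rc_process F X" and k: "0 < k"
  shows "(\<lambda>\<omega>. if k \<le> Y t \<omega> then X (arrival k \<omega>) \<omega> else 0) \<in> borel_measurable H"
proof (rule borel_measurable_LIMSEQ_real)
  note [measurable] = Y_meas[OF H t] Y_meas[OF H grid_nonneg]
  fix m
  have [measurable]: "slot m k \<in> measurable H (count_space UNIV)" unfolding slot_def by measurable
  have [measurable]: "(\<lambda>\<omega>. X (grid m i) \<omega>) \<in> borel_measurable H" for i
    using rc_processD(1)[OF X grid_nonneg[of m i]] H(1,2) space_F by (auto simp: measurable_def)
  have [measurable]: "(\<lambda>\<omega>. X (grid m (slot m k \<omega>)) \<omega>) \<in> borel_measurable H"
    by (rule measurable_compose_countable[where f="\<lambda>i \<omega>. X (grid m i) \<omega>"]) auto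
  show "(\<lambda>\<omega>. if k \<le> Y t \<omega> then X (grid m (slot m k \<omega>)) \<omega> else 0) \<in> borel_measurable H" by measurable
next
  fix \<omega> assume "\<omega> \<in> space H"
  then show "(\<lambda>m. if k \<le> Y t \<omega> then X (grid m (slot m k \<omega>)) \<omega> else 0)
      \<longlonglongrightarrow> (if k \<le> Y t \<omega> then X (arrival k \<omega>) \<omega> else 0)"
    using slot_tendsto[of \<omega> k X] H(1) k X by auto
qed

text \<open>Jobs are grouped by cell: exactly those numbered in
  \<open>{Y (grid m i) <.. Y (grid m (Suc i))}\<close> have slot \<open>Suc i\<close>. A product
  over a random number of jobs thus becomes a product over the fixed grid with clock increments as
  exponents.\<close>

lemma prod_slots:
  assumes \<omega>: "\<omega> \<in> space M"
  shows "(\<Prod>k\<in>{1..Y (grid m j) \<omega>}. f (slot m k \<omega>)) =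
    (\<Prod>i<j. f (Suc i) ^ (Y (grid m (Suc i)) \<omega> - Y (grid m i) \<omega>) :: real)"
proof (induction j)
  case 0
  then show ?case using \<omega> by simp
next
  case (Suc j)
  let ?a = "Y (grid m j) \<omega>" and ?b = "Y (grid m (Suc j)) \<omega>"
  have ab: "?a \<le> ?b" by (intro Y_mono \<omega> grid_nonneg grid_mono) simp
  have "slot m k \<omega> = Suc j" if k: "k \<in> {?a<..?b}" for k
    unfolding slot_def
  proof (rule Least_equality)
    fix i assume i: "k \<le> Y (grid m i) \<omega>"
    show "Suc j \<le> i"
    proof (rule ccontr)
      assume "\<not> Suc j \<le> i"
      then have "Y (grid m i) \<omega> \<le> ?a" by (intro Y_mono \<omega> grid_nonneg grid_mono) simp
      then show False using i k by simp
    qed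
  qed (use k in simp)
  moreover have "{1..?b} = {1..?a} \<union> {?a<..?b}" using ab by auto
  ultimately show ?case using Suc by (simp add: prod.union_disjoint ivl_disj_int)
qed

text \<open>Increments of \<open>A\<close> are integrals of \<open>L\<close>, so the sum is exactly
  the integral of \<open>L\<close> times a step function sampling \<open>X\<close> at right
  endpoints. Right-continuity of \<open>X\<close> and dominated convergence give the limit.\<close>

lemma riemann_stieltjes_tendsto:
  assumes \<omega>: "\<omega> \<in> space M" and X: "rc_process F X"
  shows "(\<lambda>m. \<Sum>i<Suc m. X (grid m (Suc i)) \<omega> * (A (grid m (Suc i)) \<omega> - A (grid m i) \<omega>))
    \<longlonglongrightarrow> integral {0..t} (\<lambda>s. X s \<omega> * L s \<omega>)"
proof (cases "t = 0")
  case True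
  have "grid m i = 0" for m i unfolding grid_def using True by simp
  then show ?thesis using True by simp
next
  case False
  with t have t0: "0 < t" by simp
  have \<omega>F: "\<omega> \<in> space F" using \<omega> by (simp add: space_F)
  \<comment> \<open>Index of the right endpoint of the left-open cell containing
    \<open>s\<close>.\<close>
  define g where "g m s = nat \<lceil>s * real (Suc m) / t\<rceil>" for m s
  define f where "f m s = X (grid m (g m s)) \<omega> * L s \<omega>" for m s
  have g_eq: "g m s = Suc i" if "grid m i < s" "s \<le> grid m (Suc i)" for m i s
  proof -
    have "real i < s * real (Suc m) / t" "s * real (Suc m) / t \<le> real (Suc i)"
      using that t0 by (auto simp: grid_def field_simps)
    then have "\<lceil>s * real (Suc m) / t\<rceil> = int i + 1" by (intro ceiling_unique) auto
    then show ?thesis by (simp add: g_def)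
  qed
  have hi: "(f m has_integral (\<Sum>i<j. X (grid m (Suc i)) \<omega> * (A (grid m (Suc i)) \<omega> - A (grid m i) \<omega>))) {0..grid m j}" for m j
  proof (induction j)
    case 0
    then show ?case by (simp add: has_integral_refl)
  next
    case (Suc j)
    let ?c = "X (grid m (Suc j)) \<omega>"
    have le: "grid m j \<le> grid m (Suc j)" by (rule grid_mono) simp
    have "((\<lambda>s. L s \<omega>) has_integral (A (grid m (Suc j)) \<omega> - A (grid m j) \<omega>)) {grid m j..grid m (Suc j)}"
      unfolding A_diff[OF \<omega> grid_nonneg le]
      by (rule integrable_integral[OF L_integrable[OF \<omega> grid_nonneg]])
    then have "((\<lambda>s. ?c * L s \<omega>) has_integral ?c * (A (grid m (Suc j)) \<omega> - A (grid m j) \<omega>)) {grid m j..grid m (Suc j)}"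
      by (rule has_integral_mult_right)
    \<comment> \<open>The left endpoint belongs to the previous cell; one point does not affect the
      integral.\<close>
    then have "(f m has_integral ?c * (A (grid m (Suc j)) \<omega> - A (grid m j) \<omega>)) {grid m j..grid m (Suc j)}"
      by (rule has_integral_spike_finite[rotated 2, of _ _ _ "{grid m j}"]) (auto simp: f_def g_eq[of m j])
    from has_integral_combine[OF grid_nonneg le Suc.IH this] show ?case by simp
  qed
  have g_le: "g m s \<le> Suc m" and g_bd: "s \<le> grid m (g m s)" "grid m (g m s) \<le> s + t / real (Suc m)"
    if s: "s \<in> {0..t}" for m s
  proof -
    let ?x = "s * real (Suc m) / t"
    have "s * real (Suc m) \<le> t * real (Suc m)" using s by (intro mult_right_mono) auto
    then have x: "0 \<le> ?x" "?x \<le> real (Suc m)" using s t0 by (auto simp: divide_le_eq mult.commute)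
    then have "\<lceil>?x\<rceil> \<le> int (Suc m)" by (simp add: ceiling_le_iff)
    then show "g m s \<le> Suc m" by (simp only: g_def nat_le_iff)
    have r: "real (g m s) = of_int \<lceil>?x\<rceil>" using x(1) by (simp add: g_def)
    have "?x \<le> real (g m s)" "real (g m s) \<le> ?x + 1"
      unfolding r using ceiling_correct[of ?x] by linarith+
    then have "t / real (Suc m) * ?x \<le> t / real (Suc m) * real (g m s)"
      "t / real (Suc m) * real (g m s) \<le> t / real (Suc m) * (?x + 1)"
      using t0 by (intro mult_left_mono; simp)+
    moreover have "t / real (Suc m) * ?x = s" using t0 by simp
    moreover have "t / real (Suc m) * (?x + 1) = t / real (Suc m) * ?x + t / real (Suc m)"
      by (simp add: distrib_left)
    moreover have "grid m (g m s) = t / real (Suc m) * real (g m s)" by (simp add: grid_def)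
    ultimately show "s \<le> grid m (g m s)" "grid m (g m s) \<le> s + t / real (Suc m)"
      by linarith+
  qed
  obtain B where B: "0 \<le> B" "\<And>s. 0 \<le> s \<Longrightarrow> s \<le> t \<Longrightarrow> \<bar>X s \<omega>\<bar> \<le> B" using rc_process_bounded[OF X \<omega>F] by blast
  obtain C where C: "0 \<le> C" "\<And>s. 0 \<le> s \<Longrightarrow> s \<le> t \<Longrightarrow> \<bar>L s \<omega>\<bar> \<le> C" using rc_process_bounded[OF L \<omega>F] by blast
  have "(\<lambda>m. integral {0..t} (f m)) \<longlonglongrightarrow> integral {0..t} (\<lambda>s. X s \<omega> * L s \<omega>)"
  proof (rule dominated_convergence(2)[where h="\<lambda>_. B * C"])
    show "f m integrable_on {0..t}" for m using hi[of m "Suc m"] by (auto simp: integrable_on_def)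
    show "norm (f m s) \<le> B * C" if "s \<in> {0..t}" for m s
      unfolding f_def using that grid_mono[OF g_le[OF that], of m m]
      by (auto simp: abs_mult intro!: mult_mono B C grid_nonneg)
    show "(\<lambda>m. f m s) \<longlonglongrightarrow> X s \<omega> * L s \<omega>" if s: "s \<in> {0..t}" for s
      unfolding f_def
    proof (intro tendsto_intros rc_process_seq[OF X \<omega>F])
      show "(\<lambda>m. grid m (g m s)) \<longlonglongrightarrow> s"
      proof (rule tendsto_sandwich[OF _ _ tendsto_const])
        have "(\<lambda>m. s + t * (1 / real (Suc m))) \<longlonglongrightarrow> s + t * 0"
          by (intro tendsto_intros LIMSEQ_Suc[OF lim_1_over_n])
        then show "(\<lambda>m. s + t / real (Suc m)) \<longlonglongrightarrow> s" by simp
      qed (intro always_eventually allI g_bd s)+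
    qed (use s g_bd in auto)
  qed auto
  moreover have "integral {0..t} (f m) = (\<Sum>i<Suc m. X (grid m (Suc i)) \<omega> * (A (grid m (Suc i)) \<omega> - A (grid m i) \<omega>))" for m
    using integral_unique[OF hi[of m "Suc m"]] by simp
  ultimately show ?thesis by simp
qed

text \<open>The Laplace functional of a Cox process, with \<open>q\<close> in place of the
  exponential of a test function. Both sides are limits of discretisations bounded by 1.\<close>

lemma cox_functional:
  assumes q: "rc_process F q" and q01: "\<And>s \<omega>. 0 \<le> s \<Longrightarrow> \<omega> \<in> space M \<Longrightarrow> 0 \<le> q s \<omega> \<and> q s \<omega> \<le> 1"
  shows "(\<integral>\<omega>. (\<Prod>k\<in>{1..Y t \<omega>}. q (arrival k \<omega>) \<omega>) \<partial>M) =
    (\<integral>\<omega>. exp (- integral {0..t} (\<lambda>s. (1 - q s \<omega>) * L s \<omega>)) \<partial>M)" (is "?lhs = ?rhs")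
proof -
  have q': "rc_process F (\<lambda>s \<omega>. 1 - q s \<omega>)"
    by (rule rc_process_compose[OF q, of "\<lambda>x. 1 - x"]) (intro continuous_intros)
  note [measurable] = measurable_F_M[OF A_meas[OF grid_nonneg]] measurable_F_M[OF rc_processD(1)[OF q grid_nonneg]]
    Y_meas[OF refl sets_F N_meas grid_nonneg]
  define f where "f m \<omega> = (\<Prod>i<Suc m. q (grid m (Suc i)) \<omega> ^ (Y (grid m (Suc i)) \<omega> - Y (grid m i) \<omega>))" for m \<omega>
  define h where "h m \<omega> = (\<Prod>i<Suc m. exp (- (1 - q (grid m (Suc i)) \<omega>) * (A (grid m (Suc i)) \<omega> - A (grid m i) \<omega>)))" for m \<omega>
  \<comment> \<open>On the grid the identity is exact for each \<open>m\<close>, with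
    \<open>A (grid m i)\<close> as random clock times.\<close>
  have eq: "(\<integral>\<omega>. f m \<omega> \<partial>M) = (\<integral>\<omega>. h m \<omega> \<partial>M)" for m
    unfolding f_def h_def Y_def
    by (rule integral_increments_pgf)
       (auto intro!: A_meas rc_processD[OF q] grid_nonneg A_nonneg A_mono grid_mono q01)
  have f_meas[measurable]: "f m \<in> borel_measurable M" for m unfolding f_def by measurable
  have h_meas[measurable]: "h m \<in> borel_measurable M" for m unfolding h_def by measurable
  have f_lim: "(\<lambda>m. f m \<omega>) \<longlonglongrightarrow> (\<Prod>k\<in>{1..Y t \<omega>}. q (arrival k \<omega>) \<omega>)" if \<omega>: "\<omega> \<in> space M" for \<omega>
  proof -
    have "f m \<omega> = (\<Prod>k\<in>{1..Y t \<omega>}. q (grid m (slot m k \<omega>)) \<omega>)" for m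
      using prod_slots[OF \<omega>, where m=m and j="Suc m" and f="\<lambda>i. q (grid m i) \<omega>"] by (simp add: f_def)
    moreover have "(\<lambda>m. \<Prod>k\<in>{1..Y t \<omega>}. q (grid m (slot m k \<omega>)) \<omega>) \<longlonglongrightarrow> (\<Prod>k\<in>{1..Y t \<omega>}. q (arrival k \<omega>) \<omega>)"
      by (intro tendsto_prod slot_tendsto q \<omega>) auto
    ultimately show ?thesis by simp
  qed
  have h_lim: "(\<lambda>m. h m \<omega>) \<longlonglongrightarrow> exp (- integral {0..t} (\<lambda>s. (1 - q s \<omega>) * L s \<omega>))" if \<omega>: "\<omega> \<in> space M" for \<omega>
  proof -
    have "h m \<omega> = exp (- (\<Sum>i<Suc m. (1 - q (grid m (Suc i)) \<omega>) * (A (grid m (Suc i)) \<omega> - A (grid m i) \<omega>)))" for m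
      unfolding h_def exp_sum[OF finite_lessThan, symmetric] by (simp only: sum_negf mult_minus_left)
    then show ?thesis
      using tendsto_exp[OF tendsto_minus[OF riemann_stieltjes_tendsto[OF \<omega> q']]] by simp
  qed
  have f1: "\<bar>f m \<omega>\<bar> \<le> 1" if "\<omega> \<in> space M" for m \<omega>
    unfolding f_def abs_prod using q01[OF grid_nonneg that]
    by (intro prod_le_1) (auto simp: power_abs intro!: power_le_one)
  have h1: "\<bar>h m \<omega>\<bar> \<le> 1" if \<omega>: "\<omega> \<in> space M" for m \<omega>
  proof -
    have "(q (grid m (Suc i)) \<omega> - 1) * (A (grid m (Suc i)) \<omega> - A (grid m i) \<omega>) \<le> 0" for i
      using q01[OF grid_nonneg \<omega>, of m "Suc i"] A_mono[OF \<omega> grid_nonneg grid_mono, of i "Suc i" m]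
      by (intro mult_nonpos_nonneg) auto
    then show ?thesis unfolding h_def abs_prod by (intro prod_le_1) auto
  qed
  have "(\<lambda>m. \<integral>\<omega>. f m \<omega> \<partial>M) \<longlonglongrightarrow> ?lhs"
    by (rule integral_dominated_convergence[where w="\<lambda>_. 1"])
       (auto simp del: One_nat_def intro!: AE_I2 f_lim f1 borel_measurable_LIMSEQ_real[OF f_lim f_meas])
  moreover have "(\<lambda>m. \<integral>\<omega>. h m \<omega> \<partial>M) \<longlonglongrightarrow> ?rhs"
    by (rule integral_dominated_convergence[where w="\<lambda>_. 1"])
       (auto intro!: AE_I2 h_lim h1 borel_measurable_LIMSEQ_real[OF h_lim h_meas])
  ultimately show ?thesis unfolding eq by (rule LIMSEQ_unique)
qed

section \<open>Thinning by the service requirements\<close>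

text \<open>\<open>D s\<close> is the threshold that a requirement must exceed for a job arriving at
  \<open>s\<close> to be present. Freezing the \<open>H\<close>-measurable arrivals and thresholds
  first leaves a functional of the arrival process alone.\<close>

lemma thinned_pgf:
  assumes H: "space H = space M" "sets F \<subseteq> sets H" "N \<in> measurable H (Pi\<^sub>M UNIV (\<lambda>_. count_space UNIV))"
      "sets H \<subseteq> sets M"
    and Z_meas: "Z \<in> measurable M (Pi\<^sub>M UNIV (\<lambda>_. borel))"
    and Z_ind: "indep_set (sets H) (sigma_sets (space M) {Z -` B \<inter> space M | B. B \<in> sets (Pi\<^sub>M UNIV (\<lambda>_. borel))})"
    and Z_iid: "indep_vars (\<lambda>_. borel) (\<lambda>k \<omega>. Z \<omega> k) UNIV"
    and Z_exp: "\<And>k::nat. distributed M lborel (\<lambda>\<omega>. Z \<omega> k) (\<lambda>x. ennreal (exponential_density 1 x))"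
    and D: "rc_process F D" and D_nonneg: "\<And>s \<omega>. 0 \<le> s \<Longrightarrow> \<omega> \<in> space M \<Longrightarrow> 0 \<le> D s \<omega>"
    and z: "0 \<le> z" "z \<le> 1"
  shows "(\<integral>\<omega>. z ^ card {k \<in> {1..Y t \<omega>}. D (arrival k \<omega>) \<omega> < Z \<omega> k} \<partial>M) =
    (\<integral>\<omega>. exp (- (1 - z) * integral {0..t} (\<lambda>s. L s \<omega> * exp (- D s \<omega>))) \<partial>M)"
proof -
  let ?PR = "Pi\<^sub>M UNIV (\<lambda>_::nat. borel :: real measure)"
  \<comment> \<open>The default 0 beyond the actual jobs makes \<open>d\<close> a full sequence of
    \<open>H\<close>-measurable variables, as an element of the product space has to be.\<close>
  define d where "d k \<omega> = (if 0 < k \<and> k \<le> Y t \<omega> then D (arrival k \<omega>) \<omega> else 0)" for k \<omega>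
  have d_meas: "d k \<in> borel_measurable H" for k
    using at_arrival_meas[OF H(1-3) D, of k] by (cases "0 < k") (auto simp: d_def[abs_def])
  have d_nonneg: "0 \<le> d k \<omega>" if "\<omega> \<in> space M" for k \<omega>
    using that by (auto simp: d_def intro!: D_nonneg arrival_bounds)
  define f where "f p = (\<Prod>k\<in>{1..fst (fst p)}. if snd (fst p) k < snd p k then z else 1)"
    for p :: "(nat \<times> (nat \<Rightarrow> real)) \<times> (nat \<Rightarrow> real)"
  have f_meas: "f \<in> borel_measurable ((count_space UNIV \<Otimes>\<^sub>M ?PR) \<Otimes>\<^sub>M ?PR)"
    unfolding f_def
    by (rule measurable_compose_countable[where f="\<lambda>n p. \<Prod>k\<in>{1..n}. if snd (fst p) k < snd p k then z else 1"]) measurable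
  have f1: "\<bar>f p\<bar> \<le> 1" for p
    unfolding f_def abs_prod using z by (intro prod_le_1) auto
  let ?W = "\<lambda>\<omega>. (Y t \<omega>, \<lambda>k. d k \<omega>)"
  have W: "?W \<in> measurable H (count_space UNIV \<Otimes>\<^sub>M ?PR)"
    by (intro measurable_Pair measurable_PiM_single' Y_meas[OF H(1-3) t]) (auto simp: d_meas)
  then have WM: "?W \<in> measurable M (count_space UNIV \<Otimes>\<^sub>M ?PR)"
    using H(1,4) by (auto simp: measurable_def)
  have single: "(\<integral>\<omega>. (if x < Z \<omega> k then z else 1) \<partial>M) = 1 - (1 - z) * exp (- x)" if "0 \<le> x" for x k
  proof -
    have [measurable]: "(\<lambda>\<omega>. Z \<omega> k) \<in> borel_measurable M" using distributed_measurable[OF Z_exp[of k]] by simp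
    have "(\<integral>\<omega>. (if x < Z \<omega> k then z else 1) \<partial>M) = (\<integral>\<omega>. 1 - (1 - z) * indicator {\<omega> \<in> space M. x < Z \<omega> k} \<omega> \<partial>M)"
      by (intro Bochner_Integration.integral_cong) auto
    also have "\<dots> = 1 - (1 - z) * prob {\<omega> \<in> space M. x < Z \<omega> k}"
      by (subst Bochner_Integration.integral_diff) (auto simp: prob_space emeasure_eq_measure)
    also have "prob {\<omega> \<in> space M. x < Z \<omega> k} = exp (- x)"
      using exponential_distributedD_gt[OF Z_exp[of k] that] by simp
    finally show ?thesis .
  qed
  have "(\<integral>\<omega>. z ^ card {k \<in> {1..Y t \<omega>}. D (arrival k \<omega>) \<omega> < Z \<omega> k} \<partial>M) = (\<integral>\<omega>. f (?W \<omega>, Z \<omega>) \<partial>M)"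
  proof (intro Bochner_Integration.integral_cong refl)
    fix \<omega>
    have "f (?W \<omega>, Z \<omega>) = z ^ card ({1..Y t \<omega>} \<inter> {k. d k \<omega> < Z \<omega> k})"
      by (simp add: f_def prod.If_cases)
    also have "{1..Y t \<omega>} \<inter> {k. d k \<omega> < Z \<omega> k} = {k \<in> {1..Y t \<omega>}. D (arrival k \<omega>) \<omega> < Z \<omega> k}"
      by (auto simp: d_def)
    finally show "z ^ card {k \<in> {1..Y t \<omega>}. D (arrival k \<omega>) \<omega> < Z \<omega> k} = f (?W \<omega>, Z \<omega>)" ..
  qed
  also have "\<dots> = (\<integral>\<omega>. (\<integral>\<omega>'. f (?W \<omega>, Z \<omega>') \<partial>M) \<partial>M)"
  proof (rule integral_indep_freeze[OF WM Z_meas Z_ind _ _ f_meas f1])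
    show "?W -` B \<inter> space M \<in> sets H" if "B \<in> sets (count_space UNIV \<Otimes>\<^sub>M ?PR)" for B
      using measurable_sets[OF W that] by (simp add: H(1))
  qed auto
  \<comment> \<open>With the thresholds frozen the jobs are independent, and each contributes the
    mean of \<open>z\<close> or 1 according to an exponential tail event.\<close>
  also have "\<dots> = (\<integral>\<omega>. (\<Prod>k\<in>{1..Y t \<omega>}. 1 - (1 - z) * exp (- D (arrival k \<omega>) \<omega>)) \<partial>M)"
  proof (intro Bochner_Integration.integral_cong refl)
    fix \<omega> assume \<omega>: "\<omega> \<in> space M"
    have ind: "indep_vars (\<lambda>_. borel) (\<lambda>k \<omega>'. if d k \<omega> < Z \<omega>' k then z else 1) {1..Y t \<omega>}"
      by (rule indep_vars_compose2[OF indep_vars_subset[OF Z_iid]]) auto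
    have "(\<integral>\<omega>'. f (?W \<omega>, Z \<omega>') \<partial>M) = (\<integral>\<omega>'. (\<Prod>k\<in>{1..Y t \<omega>}. if d k \<omega> < Z \<omega>' k then z else 1) \<partial>M)"
      by (simp add: f_def)
    also have "\<dots> = (\<Prod>k\<in>{1..Y t \<omega>}. \<integral>\<omega>'. (if d k \<omega> < Z \<omega>' k then z else 1) \<partial>M)"
    proof (rule indep_vars_lebesgue_integral[OF _ ind])
      show "integrable M (\<lambda>\<omega>'. if d k \<omega> < Z \<omega>' k then z else 1)" if "k \<in> {1..Y t \<omega>}" for k
        using ind that z by (intro integrable_const_bound[where B=1]) (auto simp: indep_vars_def)
    qed simp
    also have "\<dots> = (\<Prod>k\<in>{1..Y t \<omega>}. 1 - (1 - z) * exp (- D (arrival k \<omega>) \<omega>))"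
      by (intro prod.cong refl) (simp add: single d_nonneg[OF \<omega>], simp add: d_def)
    finally show "(\<integral>\<omega>'. f (?W \<omega>, Z \<omega>') \<partial>M) = (\<Prod>k\<in>{1..Y t \<omega>}. 1 - (1 - z) * exp (- D (arrival k \<omega>) \<omega>))" .
  qed
  \<comment> \<open>Here \<open>1 - q\<close> is \<open>(1 - z) * exp (- D)\<close>: up to
    \<open>1 - z\<close>, the probability that a job is retained.\<close>
  also have "\<dots> = (\<integral>\<omega>. exp (- integral {0..t} (\<lambda>s. (1 - (1 - (1 - z) * exp (- D s \<omega>))) * L s \<omega>)) \<partial>M)"
  proof (rule cox_functional)
    show "rc_process F (\<lambda>s \<omega>. 1 - (1 - z) * exp (- D s \<omega>))"
      by (rule rc_process_compose[OF D, of "\<lambda>x. 1 - (1 - z) * exp (- x)"]) (intro continuous_intros)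
    fix s :: real and \<omega> assume *: "0 \<le> s" "\<omega> \<in> space M"
    have "(1 - z) * exp (- D s \<omega>) \<le> 1 * 1" using z D_nonneg[OF *] by (intro mult_mono) auto
    then show "0 \<le> 1 - (1 - z) * exp (- D s \<omega>) \<and> 1 - (1 - z) * exp (- D s \<omega>) \<le> 1" using z by simp
  qed
  also have "\<dots> = (\<integral>\<omega>. exp (- (1 - z) * integral {0..t} (\<lambda>s. L s \<omega> * exp (- D s \<omega>))) \<partial>M)"
  proof -
    have "integral {0..t} (\<lambda>s. (1 - (1 - (1 - z) * exp (- D s \<omega>))) * L s \<omega>) =
        (1 - z) * integral {0..t} (\<lambda>s. L s \<omega> * exp (- D s \<omega>))" for \<omega>
      by (subst integral_mult_right[symmetric]) (simp add: mult_ac)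
    then show ?thesis by (simp only: mult_minus_left)
  qed
  finally show ?thesis .
qed

end

section \<open>The modulated infinite-server queue\<close>

text \<open>The identity is known only on \<open>[0,1)\<close>, hence the one-sided limit: once the
  lower coefficients vanish, divide by \<open>z ^ n\<close> and let \<open>z\<close> decrease to
  0.\<close>

lemma powser_coeffs_eq_0:
  fixes d :: "nat \<Rightarrow> real"
  assumes s: "\<And>z. 0 \<le> z \<Longrightarrow> z < 1 \<Longrightarrow> (\<lambda>k. d k * z ^ k) sums 0"
  shows "d n = 0"
proof (induction n rule: less_induct)
  case (less n)
  have shift: "(\<lambda>k. d (k + n) * z ^ k) sums 0" if z: "0 < z" "z < 1" for z
  proof -
    have "(\<lambda>k. d (k + n) * z ^ (k + n)) sums (0 - (\<Sum>k<n. d k * z ^ k))"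
      using s[of z] z by (subst sums_iff_shift) simp
    then have "(\<lambda>k. d (k + n) * z ^ (k + n) / z ^ n) sums (0 / z ^ n)"
      using less by (intro sums_divide) simp
    then show ?thesis using z by (simp add: power_add)
  qed
  have summ: "summable (\<lambda>k. d (k + n) * z ^ k)" if "\<bar>z\<bar> < 1/2" for z
    by (rule powser_inside[OF sums_summable[OF shift[of "1/2"]]]) (use that in auto)
  have "((\<lambda>z. \<Sum>k. d (k + n) * z ^ k) \<longlongrightarrow> d (0 + n)) (at 0)"
    by (rule powser_limit_0[of "1/2" "\<lambda>k. d (k + n)"]) (auto intro!: summable_sums summ)
  then have "((\<lambda>z. \<Sum>k. d (k + n) * z ^ k) \<longlongrightarrow> d n) (at_right 0)"
    by (auto intro: filterlim_mono at_le)
  moreover have "\<forall>\<^sub>F z in at_right 0. (\<Sum>k. d (k + n) * z ^ k) = 0"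
    unfolding eventually_at_right_field by (auto intro!: exI[of _ 1] sums_unique[symmetric] shift)
  then have "((\<lambda>z. \<Sum>k. d (k + n) * z ^ k) \<longlongrightarrow> 0) (at_right 0)"
    by (rule tendsto_eventually)
  ultimately show ?case using tendsto_unique trivial_limit_at_right_real by blast
qed

text \<open>Sum and integral are exchanged by domination with the geometric series, which is why
  \<open>z < 1\<close>.\<close>

lemma (in prob_space) integral_powser_sums:
  fixes p :: "nat \<Rightarrow> 'a \<Rightarrow> real"
  assumes [measurable]: "\<And>k. p k \<in> borel_measurable M"
    and p: "\<And>k \<omega>. \<omega> \<in> space M \<Longrightarrow> 0 \<le> p k \<omega> \<and> p k \<omega> \<le> 1" and z: "0 \<le> z" "z < 1"
  shows "(\<lambda>k. (\<integral>\<omega>. p k \<omega> \<partial>M) * z ^ k) sums (\<integral>\<omega>. (\<Sum>k. p k \<omega> * z ^ k) \<partial>M)"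
proof -
  have geo: "summable (\<lambda>k. z ^ k)" by (rule summable_geometric) (use z in simp)
  have int: "integrable M (p k)" for k
    by (rule integrable_const_bound[where B=1]) (auto simp: p)
  have "(\<lambda>k. \<integral>\<omega>. p k \<omega> * z ^ k \<partial>M) sums (\<integral>\<omega>. (\<Sum>k. p k \<omega> * z ^ k) \<partial>M)"
  proof (rule sums_integral)
    show "integrable M (\<lambda>\<omega>. p k \<omega> * z ^ k)" for k using int by simp
    show "AE \<omega> in M. summable (\<lambda>k. norm (p k \<omega> * z ^ k))"
      using z by (intro AE_I2 summable_comparison_test'[OF geo, of 0])
        (auto simp: abs_mult power_abs p intro!: mult_left_le_one_le)
    have "(\<integral>\<omega>. norm (p k \<omega> * z ^ k) \<partial>M) \<le> z ^ k" for k
    proof -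
      have "(\<integral>\<omega>. norm (p k \<omega> * z ^ k) \<partial>M) \<le> (\<integral>\<omega>. z ^ k \<partial>M)"
        using int z by (intro integral_mono) (auto simp: abs_mult power_abs p intro!: mult_left_le_one_le)
      then show ?thesis by (simp add: prob_space)
    qed
    then show "summable (\<lambda>k. \<integral>\<omega>. norm (p k \<omega> * z ^ k) \<partial>M)"
      by (intro summable_comparison_test'[OF geo, of 0]) (auto simp: integral_nonneg_AE)
  qed
  then show ?thesis by simp
qed

text \<open>The assumed right-hand side is the generating function of the Poisson mixture; both are
  power series with the point probabilities as coefficients, which are therefore equal.\<close>

lemma (in prob_space) mixed_poisson_of_pgf:
  assumes X[measurable]: "X \<in> measurable M (count_space UNIV)"
    and P[measurable]: "\<Phi> \<in> borel_measurable M" and nn: "\<And>\<omega>. \<omega> \<in> space M \<Longrightarrow> 0 \<le> \<Phi> \<omega>"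
    and pgf: "\<And>z. 0 \<le> z \<Longrightarrow> z \<le> 1 \<Longrightarrow> (\<integral>\<omega>. z ^ X \<omega> \<partial>M) = (\<integral>\<omega>. exp (- (1 - z) * \<Phi> \<omega>) \<partial>M)"
  shows "prob {\<omega> \<in> space M. X \<omega> = k} = (\<integral>\<omega>. pois (\<Phi> \<omega>) k \<partial>M)"
proof -
  have "prob {\<omega> \<in> space M. X \<omega> = k} - (\<integral>\<omega>. pois (\<Phi> \<omega>) k \<partial>M) = 0"
  proof (rule powser_coeffs_eq_0)
    fix z :: real assume z: "0 \<le> z" "z < 1"
    have ind: "(\<Sum>k. (if X \<omega> = k then 1 else 0) * z ^ k) = z ^ X \<omega>" for \<omega>
      using sums_unique[OF sums_single[of "X \<omega>" "\<lambda>k. z ^ k"]]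
      by (simp add: if_distrib[of "\<lambda>x. x * _"] eq_commute cong: if_cong)
    have "(\<lambda>k. (\<integral>\<omega>. (if X \<omega> = k then 1 else 0) \<partial>M) * z ^ k) sums (\<integral>\<omega>. (\<Sum>k. (if X \<omega> = k then 1 else 0) * z ^ k) \<partial>M)"
      by (rule integral_powser_sums) (use z in auto)
    moreover have "(\<integral>\<omega>. (if X \<omega> = k then 1 else 0) \<partial>M) = prob {\<omega> \<in> space M. X \<omega> = k}" for k
    proof -
      have "(\<integral>\<omega>. (if X \<omega> = k then 1 else 0) \<partial>M) = (\<integral>\<omega>. indicator {\<omega> \<in> space M. X \<omega> = k} \<omega> \<partial>M :: real)"
        by (intro Bochner_Integration.integral_cong) auto
      then show ?thesis by simp
    qed
    ultimately have sX: "(\<lambda>k. prob {\<omega> \<in> space M. X \<omega> = k} * z ^ k) sums (\<integral>\<omega>. z ^ X \<omega> \<partial>M)"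
      by (simp add: ind)
    have "(\<lambda>k. (\<integral>\<omega>. pois (\<Phi> \<omega>) k \<partial>M) * z ^ k) sums (\<integral>\<omega>. (\<Sum>k. pois (\<Phi> \<omega>) k * z ^ k) \<partial>M)"
    proof (rule integral_powser_sums)
      show "(\<lambda>\<omega>. pois (\<Phi> \<omega>) k) \<in> borel_measurable M" for k unfolding pois_def by measurable
    qed (use z in \<open>auto simp: nn pois_nonneg pois_le_1\<close>)
    moreover have "(\<Sum>k. pois x k * z ^ k) = exp (- (1 - z) * x)" for x
      by (rule sums_unique[OF pois_pgf_sums, symmetric])
    ultimately have "(\<lambda>k. (\<integral>\<omega>. pois (\<Phi> \<omega>) k \<partial>M) * z ^ k) sums (\<integral>\<omega>. z ^ X \<omega> \<partial>M)"
      using pgf[of z] z by (simp only:)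
    from sums_diff[OF sX this]
    show "(\<lambda>k. (prob {\<omega> \<in> space M. X \<omega> = k} - (\<integral>\<omega>. pois (\<Phi> \<omega>) k \<partial>M)) * z ^ k) sums 0"
      by (simp add: left_diff_distrib)
  qed
  then show ?thesis by simp
qed

lemma measurable_card_filter:
  assumes [measurable]: "n \<in> measurable M (count_space UNIV)"
    and P[measurable]: "\<And>k. Measurable.pred M (P k)"
  shows "(\<lambda>\<omega>. card {k \<in> {1..n \<omega> :: nat}. P k \<omega>}) \<in> measurable M (count_space UNIV)"
proof (rule measurable_compose_countable[where f="\<lambda>m \<omega>. card {k \<in> {1..m}. P k \<omega>}"])
  fix m :: nat
  have "card {k \<in> {1..m}. P k \<omega>} = nat \<lfloor>\<Sum>k\<in>{1..m}. if P k \<omega> then 1 else 0 :: real\<rfloor>" for \<omega>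
    by (simp add: sum.If_cases Int_def)
  then show "(\<lambda>\<omega>. card {k \<in> {1..m}. P k \<omega>}) \<in> measurable M (count_space UNIV)" by simp
qed fact

lemma rc_process_cadlag:
  fixes J :: "'a \<Rightarrow> real \<Rightarrow> 'e::metric_space" and g :: "'e \<Rightarrow> real"
  assumes J: "J \<in> measurable F (Pi\<^sub>M UNIV (\<lambda>_. borel))" and cad: "\<And>\<omega>. \<omega> \<in> space F \<Longrightarrow> cadlag (J \<omega>)"
    and g: "continuous_on UNIV g"
  shows "rc_process F (\<lambda>s \<omega>. g (J \<omega> s))"
proof (rule rc_processI)
  fix s :: real
  show "(\<lambda>\<omega>. g (J \<omega> s)) \<in> borel_measurable F"
    using measurable_compose[OF measurable_compose[OF J measurable_component_singleton[of s]]
        borel_measurable_continuous_onI[OF g]] by simp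
next
  fix \<omega> assume \<omega>: "\<omega> \<in> space F"
  have c: "cadlag (\<lambda>s. g (J \<omega> s))" by (rule cadlag_compose[OF cad[OF \<omega>] g])
  show "((\<lambda>s. g (J \<omega> s)) \<longlongrightarrow> g (J \<omega> s)) (at_right s)" if "0 \<le> s" for s
    using c that by (simp add: cadlag_def)
  show "\<exists>B. \<forall>s\<in>{0..T}. \<bar>g (J \<omega> s)\<bar> \<le> B" for T
    using cadlag_bounded[OF c] by metis
qed

lemma (in prob_space) queue_count_mixed_poisson:
  fixes J :: "'a \<Rightarrow> real \<Rightarrow> 'e::metric_space"
  assumes cont: "continuous_on UNIV lam" "continuous_on UNIV kap" "continuous_on UNIV mu"
    and nonneg: "\<And>x. 0 \<le> lam x" "\<And>x. 0 \<le> kap x" "\<And>x. 0 \<le> mu x"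
    and t: "0 \<le> t"
    and J: "J \<in> measurable M (Pi\<^sub>M UNIV (\<lambda>_. borel))"
    and cad: "\<And>\<omega>. \<omega> \<in> space M \<Longrightarrow> cadlag (J \<omega>)"
    and N: "std_poisson_process M N"
    and Z_iid: "indep_vars (\<lambda>_. borel) (\<lambda>k \<omega>. Z \<omega> k) UNIV"
    and Z_exp: "\<And>k. distributed M lborel (\<lambda>\<omega>. Z \<omega> k) (\<lambda>x. ennreal (exponential_density 1 x))"
    and JN: "indep_rv M (Pi\<^sub>M UNIV (\<lambda>_. borel)) J (Pi\<^sub>M UNIV (\<lambda>_. count_space UNIV)) N"
    and JNZ: "indep_rv M (Pi\<^sub>M UNIV (\<lambda>_. borel) \<Otimes>\<^sub>M Pi\<^sub>M UNIV (\<lambda>_. count_space UNIV)) (\<lambda>\<omega>. (J \<omega>, N \<omega>))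
        (Pi\<^sub>M UNIV (\<lambda>_. borel)) Z"
  shows "(\<lambda>\<omega>. queue_count lam kap mu (J \<omega>) (N \<omega>) (Z \<omega>) t) \<in> measurable M (count_space UNIV)" (is ?meas)
    and "(\<lambda>\<omega>. phi lam kap mu t (J \<omega>)) \<in> borel_measurable M" (is ?phi)
    and "\<And>\<omega>. \<omega> \<in> space M \<Longrightarrow> 0 \<le> phi lam kap mu t (J \<omega>)"
    and "\<And>k. prob {\<omega> \<in> space M. queue_count lam kap mu (J \<omega>) (N \<omega>) (Z \<omega>) t = k} =
      (\<integral>\<omega>. pois (phi lam kap mu t (J \<omega>)) k \<partial>M)"
proof -
  let ?PJ = "Pi\<^sub>M UNIV (\<lambda>_::real. borel :: 'e measure)"
  let ?PN = "Pi\<^sub>M UNIV (\<lambda>_::real. count_space (UNIV :: nat set))"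
  have Nm: "N \<in> measurable M ?PN" using N by (simp add: std_poisson_process_def)
  have Zm: "Z \<in> measurable M (Pi\<^sub>M UNIV (\<lambda>_. borel))" using JNZ by (simp add: indep_rv_def)
  \<comment> \<open>\<open>F\<close> is generated by the background and \<open>H\<close> by
    background and clock, so the two independence hypotheses become statements about these
    sigma-algebras.\<close>
  define F where "F = vimage_algebra (space M) J ?PJ"
  define H where "H = vimage_algebra (space M) (\<lambda>\<omega>. (J \<omega>, N \<omega>)) (?PJ \<Otimes>\<^sub>M ?PN)"
  have sp[simp]: "space F = space M" "space H = space M" by (simp_all add: F_def H_def)
  have JF: "J \<in> measurable F ?PJ"
    unfolding F_def by (rule measurable_vimage_algebra1) (auto intro: measurable_space[OF J])
  have JNH: "(\<lambda>\<omega>. (J \<omega>, N \<omega>)) \<in> measurable H (?PJ \<Otimes>\<^sub>M ?PN)"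
    unfolding H_def by (rule measurable_vimage_algebra1)
      (auto simp: space_pair_measure intro: measurable_space[OF J] measurable_space[OF Nm])
  have JH: "J \<in> measurable H ?PJ" and NH: "N \<in> measurable H ?PN"
    using measurable_compose[OF JNH measurable_fst] measurable_compose[OF JNH measurable_snd] by simp_all
  have FH: "sets F \<subseteq> sets H"
    using JH unfolding F_def by (intro sets_image_in_sets') (auto simp flip: sp(2))
  have HM: "sets H \<subseteq> sets M"
    unfolding H_def by (rule sets_image_in_sets[OF refl]) (intro measurable_Pair J Nm)
  define L where "L s \<omega> = lam (J \<omega> s)" for s \<omega>
  define K where "K s \<omega> = kap (J \<omega> s)" for s \<omega>
  define V where "V s \<omega> = integral {s..t} (\<lambda>r. mu (J \<omega> r))" for s \<omega>
  \<comment> \<open>For positive \<open>K\<close>, the condition \<open>V < Z / K\<close> is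
    \<open>K * V < Z\<close>; the product removes the division and also makes sense at
    \<open>K = 0\<close>.\<close>
  define D where "D s \<omega> = K s \<omega> * V s \<omega>" for s \<omega>
  have L: "rc_process F L" unfolding L_def by (rule rc_process_cadlag[OF JF _ cont(1)]) (simp add: cad)
  have K: "rc_process F K" unfolding K_def by (rule rc_process_cadlag[OF JF _ cont(2)]) (simp add: cad)
  have V: "rc_process F V" unfolding V_def
    by (rule rc_process_integral, rule rc_process_cadlag[OF JF _ cont(3)]) (simp add: cad)
  have D: "rc_process F D" unfolding D_def by (rule rc_process_mult[OF K V])
  \<comment> \<open>This holds for all \<open>s\<close> and \<omega>, because a non-integrable
    function has integral 0 by convention.\<close>
  have V_nonneg: "0 \<le> V s \<omega>" for s \<omega>
    unfolding V_def
    by (cases "(\<lambda>r. mu (J \<omega> r)) integrable_on {s..t}")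
       (auto intro: integral_nonneg simp: nonneg not_integrable_integral)
  have D_nonneg: "0 \<le> D s \<omega>" for s \<omega>
    by (simp add: D_def K_def V_nonneg nonneg)
  interpret cox_clock M F L N t
    using FH HM JN N L t nonneg(1)
    by unfold_locales (auto simp: indep_rv_def L_def F_def sets_vimage_algebra)
  note H = sp(2) FH NH
  have phi: "phi lam kap mu t (J \<omega>) = integral {0..t} (\<lambda>s. L s \<omega> * exp (- D s \<omega>))" for \<omega>
    by (simp add: phi_def L_def D_def K_def V_def)
  have LD: "rc_process F (\<lambda>s \<omega>. L s \<omega> * exp (- D s \<omega>))"
    by (rule rc_process_mult[OF L rc_process_compose[OF D, of "\<lambda>x. exp (- x)"]]) (intro continuous_intros)
  show phi_meas: ?phi
    unfolding phi by (rule measurable_F_M[OF rc_process_integral_measurable[OF LD]]) simp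
  show phi_nonneg: "0 \<le> phi lam kap mu t (J \<omega>)" if "\<omega> \<in> space M" for \<omega>
    unfolding phi
    by (intro integral_nonneg rc_process_integrable_on[OF LD]) (use that nonneg in \<open>auto simp: L_def\<close>)
  have queue: "queue_count lam kap mu (J \<omega>) (N \<omega>) (Z \<omega>) t =
      card {k \<in> {1..Y t \<omega>}. K (arrival k \<omega>) \<omega> = 0 \<or> V (arrival k \<omega>) \<omega> < Z \<omega> k / K (arrival k \<omega>) \<omega>}" for \<omega>
    by (simp add: queue_count_def Let_def Y_def A_def arrival_def L_def K_def V_def)
  have [measurable]: "(\<lambda>\<omega>. Z \<omega> k) \<in> borel_measurable M" for k
    using distributed_measurable[OF Z_exp[of k]] by simp
  note YM[measurable] = Y_meas[OF refl sets_F N_meas t]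
  \<comment> \<open>Only jobs with \<open>1 \<le> k \<le> Y t\<close> are counted; on them this
    agrees with the value at arrival, and elsewhere the default 0 secures measurability.\<close>
  define atk where "atk X k \<omega> = (if 0 < k \<and> k \<le> Y t \<omega> then X (arrival k \<omega>) \<omega> else 0)"
    for X :: "real \<Rightarrow> 'a \<Rightarrow> real" and k \<omega>
  have atk_meas: "atk X k \<in> borel_measurable M" if "rc_process F X" for X k
    using at_arrival_meas[OF refl sets_F N_meas that, of k] by (cases "0 < k") (auto simp: atk_def[abs_def])
  note [measurable] = atk_meas[OF K] atk_meas[OF V] atk_meas[OF D]
  have "(\<lambda>\<omega>. card {k \<in> {1..Y t \<omega>}. atk K k \<omega> = 0 \<or> atk V k \<omega> < Z \<omega> k / atk K k \<omega>}) \<in> measurable M (count_space UNIV)"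
    by (rule measurable_card_filter) measurable
  also have "(\<lambda>\<omega>. card {k \<in> {1..Y t \<omega>}. atk K k \<omega> = 0 \<or> atk V k \<omega> < Z \<omega> k / atk K k \<omega>}) =
      (\<lambda>\<omega>. queue_count lam kap mu (J \<omega>) (N \<omega>) (Z \<omega>) t)"
    unfolding queue by (intro ext arg_cong[where f=card] Collect_cong) (auto simp: atk_def)
  finally show meas: ?meas .
  have "(\<lambda>\<omega>. card {k \<in> {1..Y t \<omega>}. atk D k \<omega> < Z \<omega> k}) \<in> measurable M (count_space UNIV)"
    by (rule measurable_card_filter) measurable
  also have "(\<lambda>\<omega>. card {k \<in> {1..Y t \<omega>}. atk D k \<omega> < Z \<omega> k}) =
      (\<lambda>\<omega>. card {k \<in> {1..Y t \<omega>}. D (arrival k \<omega>) \<omega> < Z \<omega> k})"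
    by (intro ext arg_cong[where f=card] Collect_cong) (auto simp: atk_def)
  finally have measD: "(\<lambda>\<omega>. card {k \<in> {1..Y t \<omega>}. D (arrival k \<omega>) \<omega> < Z \<omega> k}) \<in> measurable M (count_space UNIV)" .
  \<comment> \<open>At \<open>K = 0\<close> the queue counts the job unconditionally, whereas the
    threshold form asks \<open>0 < Z\<close>. The two counts thus agree almost surely.\<close>
  have "AE \<omega> in M. 0 < Z \<omega> k" for k
    using exponential_distributedD_gt[OF Z_exp[of k], of 0] by (intro prob_Collect_eq_1[THEN iffD1]) auto
  then have "AE \<omega> in M. \<forall>k. 0 < Z \<omega> k" by (simp add: AE_all_countable)
  then have ae: "AE \<omega> in M. queue_count lam kap mu (J \<omega>) (N \<omega>) (Z \<omega>) t = card {k \<in> {1..Y t \<omega>}. D (arrival k \<omega>) \<omega> < Z \<omega> k}"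
  proof eventually_elim
    case (elim \<omega>)
    have "K s \<omega> = 0 \<or> V s \<omega> < Z \<omega> k / K s \<omega> \<longleftrightarrow> D s \<omega> < Z \<omega> k" for s k
    proof (cases "K s \<omega> = 0")
      case False
      then have "0 < K s \<omega>" using nonneg(2)[of "J \<omega> s"] by (simp add: K_def)
      then show ?thesis by (simp add: D_def field_simps)
    qed (use elim in \<open>simp add: D_def\<close>)
    then show ?case unfolding queue by simp
  qed
  fix k
  show "prob {\<omega> \<in> space M. queue_count lam kap mu (J \<omega>) (N \<omega>) (Z \<omega>) t = k} =
      (\<integral>\<omega>. pois (phi lam kap mu t (J \<omega>)) k \<partial>M)"
  proof (rule mixed_poisson_of_pgf[OF meas phi_meas phi_nonneg])
    fix z :: real assume z: "0 \<le> z" "z \<le> 1"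
    have pw: "(\<lambda>k. z ^ k) \<in> borel_measurable (count_space UNIV)" by simp
    have "(\<integral>\<omega>. z ^ queue_count lam kap mu (J \<omega>) (N \<omega>) (Z \<omega>) t \<partial>M) =
        (\<integral>\<omega>. z ^ card {k \<in> {1..Y t \<omega>}. D (arrival k \<omega>) \<omega> < Z \<omega> k} \<partial>M)"
    proof (rule integral_cong_AE)
      show "AE \<omega> in M. z ^ queue_count lam kap mu (J \<omega>) (N \<omega>) (Z \<omega>) t = z ^ card {k \<in> {1..Y t \<omega>}. D (arrival k \<omega>) \<omega> < Z \<omega> k}"
        using ae by eventually_elim simp
    qed (rule measurable_compose[OF meas pw] measurable_compose[OF measD pw])+
    also have "\<dots> = (\<integral>\<omega>. exp (- (1 - z) * phi lam kap mu t (J \<omega>)) \<partial>M)"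
      unfolding phi
      by (rule thinned_pgf[OF H HM Zm _ Z_iid Z_exp D D_nonneg z])
         (use JNZ in \<open>simp add: indep_rv_def H_def sets_vimage_algebra\<close>)
    finally show "(\<integral>\<omega>. z ^ queue_count lam kap mu (J \<omega>) (N \<omega>) (Z \<omega>) t \<partial>M) =
        (\<integral>\<omega>. exp (- (1 - z) * phi lam kap mu t (J \<omega>)) \<partial>M)" .
  qed
qed

theorem theorem1:
  fixes M :: "nat \<Rightarrow> 'a measure"
    and J :: "nat \<Rightarrow> 'a \<Rightarrow> real \<Rightarrow> 'e::metric_space"
    and Yb :: "nat \<Rightarrow> 'a \<Rightarrow> real \<Rightarrow> nat"
    and Z :: "nat \<Rightarrow> 'a \<Rightarrow> nat \<Rightarrow> real"
    and lam kap mu :: "'e \<Rightarrow> real"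
    and t :: real
    and \<psi> :: "real \<Rightarrow> ereal"
  assumes cont: "continuous_on UNIV lam" "continuous_on UNIV kap" "continuous_on UNIV mu"
    and nonneg: "\<And>x. 0 \<le> lam x" "\<And>x. 0 \<le> kap x" "\<And>x. 0 \<le> mu x"
    and t: "0 \<le> t"
    and ps: "\<And>n. prob_space (M n)"
    and J_meas: "\<And>n. J n \<in> measurable (M n) (Pi\<^sub>M UNIV (\<lambda>_. borel))"
    and J_cadlag: "\<And>n \<omega>. \<omega> \<in> space (M n) \<Longrightarrow> cadlag (J n \<omega>)"
    and Yb_poisson: "\<And>n. std_poisson_process (M n) (Yb n)"
    and Z_iid: "\<And>n. prob_space.indep_vars (M n) (\<lambda>_. borel) (\<lambda>k \<omega>. Z n \<omega> k) UNIV"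
    and Z_exp: "\<And>n k. distributed (M n) lborel (\<lambda>\<omega>. Z n \<omega> k) (\<lambda>x. ennreal (exponential_density 1 x))"
    and indep_JY: "\<And>n. indep_rv (M n)
                     (Pi\<^sub>M UNIV (\<lambda>_. borel)) (J n)
                     (Pi\<^sub>M UNIV (\<lambda>_. count_space UNIV)) (Yb n)"
    and indep_JY_Z: "\<And>n. indep_rv (M n)
                     (Pi\<^sub>M UNIV (\<lambda>_. borel) \<Otimes>\<^sub>M Pi\<^sub>M UNIV (\<lambda>_. count_space UNIV))
                     (\<lambda>\<omega>. (J n \<omega>, Yb n \<omega>))
                     (Pi\<^sub>M UNIV (\<lambda>_. borel)) (Z n)"
    and LDP_phi: "LDP (\<lambda>n. distr (M n) borel (\<lambda>\<omega>. phi lam kap mu t (J n \<omega>))) \<psi>"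
  shows "LDP (\<lambda>n. distr (M n) borel
                 (\<lambda>\<omega>. real (queue_count (\<lambda>x. real n * lam x) kap mu (J n \<omega>) (Yb n \<omega>) (Z n \<omega>) t)
                       / real n))
             (\<lambda>a. INF \<gamma>\<in>attainable M J lam kap mu t. ell \<gamma> a + \<psi> \<gamma>)"
proof (rule LDP_mixed_poisson[OF ps _ _ _ _ LDP_phi])
  \<comment> \<open>\<open>phi\<close> is linear in the arrival rate: a queue with rate
    \<open>n * lam\<close> has random Poisson mean \<open>n * phi\<close>, the scaling of the
    mixture theorem.\<close>
  have phi_n: "phi (\<lambda>x. real n * lam x) kap mu t f = real n * phi lam kap mu t f" for n f
    unfolding phi_def by (subst integral_mult_right[symmetric]) (simp add: mult.assoc)
  fix n
  note q = prob_space.queue_count_mixed_poisson[OF ps _ cont(2,3) _ nonneg(2,3) t J_meas J_cadlag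
      Yb_poisson Z_iid Z_exp indep_JY indep_JY_Z]
  have lam_n: "continuous_on UNIV (\<lambda>x. real n * lam x)" "\<And>x. 0 \<le> real n * lam x"
    using cont(1) nonneg(1) by (auto intro!: continuous_intros)
  show "(\<lambda>\<omega>. queue_count (\<lambda>x. real n * lam x) kap mu (J n \<omega>) (Yb n \<omega>) (Z n \<omega>) t) \<in> measurable (M n) (count_space UNIV)"
    by (rule q(1)[OF lam_n])
  show "(\<lambda>\<omega>. phi lam kap mu t (J n \<omega>)) \<in> borel_measurable (M n)"
    by (rule q(2)[OF cont(1) nonneg(1)])
  show "0 \<le> phi lam kap mu t (J n \<omega>)" if "\<omega> \<in> space (M n)" for \<omega>
    by (rule q(3)[OF cont(1) nonneg(1) _ that])
  show "measure (M n) {\<omega> \<in> space (M n). queue_count (\<lambda>x. real n * lam x) kap mu (J n \<omega>) (Yb n \<omega>) (Z n \<omega>) t = k} =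
      (\<integral>\<omega>. pois (real n * phi lam kap mu t (J n \<omega>)) k \<partial>M n)" for k
    using q(4)[OF lam_n] by (simp only: phi_n)
qed (simp add: attainable_def)

end
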